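(* There exist sequences $\{\mathcal{A}_k\}_{k=1}^{\infty}$ of labyrinth patterns, each of which is both horizontally and vertically blocked, such that the limit set (mixed labyrinth fractal) $L_\infty$ defined by $\{\mathcal{A}_k\}_{k=1}^{\infty}$ has the property that for any two points in $L_\infty$ the length of the arc $a\subset L_\infty$ that connects them is finite.
   Context: For an integer $m\ge 1$ let $S_{i,j,m}=\{(x,y)\mid \frac{i}{m}\le x\le\frac{i+1}{m},\ \frac{j}{m}\le y\le \frac{j+1}{m}\}$ and $\mathcal{S}_m=\{S_{i,j,m}\mid 0\le i\le m-1,\ 0\le j\le m-1\}$. A nonempty $\mathcal{A}\subseteq\mathcal{S}_m$ is called an $m$-pattern and $m$ its width; the elements of $\mathcal{A}$ are its white squares and those of $\mathcal{S}_m\setminus\mathcal{A}$ its black squares. For a square $Q=[x,x+q]\times[y,y+q]\subseteq[0,1]^2$ let $P_Q(z_x,z_y)=(qz_x+x,\,qz_y+y)$. Given a sequence of patterns $\mathcal{A}_k\subseteq\mathcal{S}_{m_k}$, $k\ge1$, put $m(n)=\prod_{k=1}^n m_k$, $\mathcal{W}_1=\mathcal{A}_1$ and, for $n\ge2$, $\mathcal{W}_n=\{P_{W'}(W)\mid W\in\mathcal{A}_n,\ W'\in\mathcal{W}_{n-1}\}\subset\mathcal{S}_{m(n)}$ (the white squares of level $n$). Let $L_n=\bigcup_{W\in\mathcal{W}_n}W$. The limit set defined by the sequence is $L_\infty=\bigcap_{n\ge1}L_n$. The graph $\mathcal{G}(\mathcal{A})$ of an $m$-pattern $\mathcal{A}$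 has the white squares as vertices, and its edges are the unordered pairs of white squares having a common side. The top row of $\mathcal{A}$ is the set of white squares in $\{S_{i,m-1,m}\mid 0\le i\le m-1\}$; bottom row, left column and right column are defined analogously. A top exit in $\mathcal{A}$ is a white square in the top row such that there is a white square in the same column in the bottom row; a bottom exit is defined analogously. A left exit is a white square in the left column such that there is a white square in the same row in the right column; a right exit is defined analogously. An $m$-pattern $\mathcal{A}$ with $m\ge3$ is a labyrinth pattern if: (1) $\mathcal{G}(\mathcal{A})$ is a tree; (2) there is exactly one top exit, exactly one bottom exit, exactly one left exit and exactly one right exit in $\mathcal{A}$; (3) if there is a white square at a corner of $\mathcal{A}$, then there is no white square at the diagonally opposite corner. When all $\mathcal{A}_k$ are labyrinth patterns, $L_\infty$ is called a mixed labyrinth fractal; it is known to be a dendrite, so any two distinct points of $L_\infty$ are connected by a unique arc in $L_\infty$. A labyrinth pattern is horizontally blocked if the row of squares from the left to the right exit contains at least one black square, and vertically blocked if the column of squares from the top to the bottom exit contains at least one black square. *)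

theory Defs
  imports "HOL-Analysis.Analysis"
begin

type_synonym plane_set = "(real \<times> real) set"

definition square :: "real \<Rightarrow> real \<Rightarrow> real \<Rightarrow> plane_set" where
  "square x y q = {x..x + q} \<times> {y..y + q}"

definition grid_square :: "nat \<Rightarrow> nat \<Rightarrow> nat \<Rightarrow> plane_set" where
  "grid_square i j m =
     {(x, y). real i / real m \<le> x \<and> x \<le> (real i + 1) / real m \<and>
              real j / real m \<le> y \<and> y \<le> (real j + 1) / real m}"

definition grid :: "nat \<Rightarrow> plane_set set" where
  "grid m = {grid_square i j m | i j. i < m \<and> j < m}"

text \<open>A pattern is its set of white squares.\<close>

definition pattern :: "nat \<Rightarrow> plane_set set \<Rightarrow> bool" where
  "pattern m A \<longleftrightarrow> m \<ge> 1 \<and> A \<noteq> {} \<and> A \<subseteq> grid m"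

definition black :: "nat \<Rightarrow> plane_set set \<Rightarrow> plane_set set" where
  "black m A = grid m - A"

text \<open>The map \<open>rescale x y q\<close> takes the unit square onto \<open>square x y q\<close>.\<close>

definition rescale :: "real \<Rightarrow> real \<Rightarrow> real \<Rightarrow> real \<times> real \<Rightarrow> real \<times> real" where
  "rescale x y q z = (q * fst z + x, q * snd z + y)"

text \<open>Sequences of patterns are indexed from 1; the entry at 0 is irrelevant.\<close>

fun white_squares :: "(nat \<Rightarrow> plane_set set) \<Rightarrow> nat \<Rightarrow> plane_set set" where
  "white_squares A 0 = {}"
| "white_squares A (Suc 0) = A 1"
| "white_squares A (Suc (Suc n)) =
     {rescale x y q ` W | W x y q.
        W \<in> A (Suc (Suc n)) \<and> q > 0 \<and> square x y q \<in> white_squares A (Suc n)}"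

definition limit_set :: "(nat \<Rightarrow> plane_set set) \<Rightarrow> plane_set" where
  "limit_set A = (\<Inter>n\<in>{1..}. \<Union> (white_squares A n))"

definition sides :: "plane_set \<Rightarrow> plane_set set" where
  "sides Q = {s. \<exists>x y q. q > 0 \<and> Q = square x y q \<and>
     s \<in> {closed_segment (x, y) (x + q, y), closed_segment (x, y + q) (x + q, y + q),
          closed_segment (x, y) (x, y + q), closed_segment (x + q, y) (x + q, y + q)}}"

definition pattern_edges :: "plane_set set \<Rightarrow> plane_set set set" where
  "pattern_edges A = {{Q, R} | Q R. Q \<in> A \<and> R \<in> A \<and> Q \<noteq> R \<and> sides Q \<inter> sides R \<noteq> {}}"

text \<open>Trees are undirected: edges are two-element sets of vertices, and a cycle has at
  least three distinct vertices.\<close>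

definition graph_connected :: "'a set \<Rightarrow> 'a set set \<Rightarrow> bool" where
  "graph_connected V E \<longleftrightarrow> V \<noteq> {} \<and> (\<forall>u\<in>V. \<forall>v\<in>V. (u, v) \<in> {(a, b). {a, b} \<in> E}\<^sup>*)"

definition graph_cycle :: "'a set set \<Rightarrow> 'a list \<Rightarrow> bool" where
  "graph_cycle E vs \<longleftrightarrow> length vs \<ge> 3 \<and> distinct vs \<and>
     (\<forall>i. Suc i < length vs \<longrightarrow> {vs ! i, vs ! Suc i} \<in> E) \<and> {last vs, hd vs} \<in> E"

definition is_tree :: "'a set \<Rightarrow> 'a set set \<Rightarrow> bool" where
  "is_tree V E \<longleftrightarrow> graph_connected V E \<and> (\<nexists>vs. graph_cycle E vs)"

definition top_exit :: "nat \<Rightarrow> plane_set set \<Rightarrow> plane_set \<Rightarrow> bool" where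
  "top_exit m A Q \<longleftrightarrow>
     (\<exists>i<m. Q = grid_square i (m - 1) m \<and> Q \<in> A \<and> grid_square i 0 m \<in> A)"

definition bottom_exit :: "nat \<Rightarrow> plane_set set \<Rightarrow> plane_set \<Rightarrow> bool" where
  "bottom_exit m A Q \<longleftrightarrow>
     (\<exists>i<m. Q = grid_square i 0 m \<and> Q \<in> A \<and> grid_square i (m - 1) m \<in> A)"

definition left_exit :: "nat \<Rightarrow> plane_set set \<Rightarrow> plane_set \<Rightarrow> bool" where
  "left_exit m A Q \<longleftrightarrow>
     (\<exists>j<m. Q = grid_square 0 j m \<and> Q \<in> A \<and> grid_square (m - 1) j m \<in> A)"

definition right_exit :: "nat \<Rightarrow> plane_set set \<Rightarrow> plane_set \<Rightarrow> bool" where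
  "right_exit m A Q \<longleftrightarrow>
     (\<exists>j<m. Q = grid_square (m - 1) j m \<and> Q \<in> A \<and> grid_square 0 j m \<in> A)"

definition labyrinth_pattern :: "nat \<Rightarrow> plane_set set \<Rightarrow> bool" where
  "labyrinth_pattern m A \<longleftrightarrow>
     pattern m A \<and> m \<ge> 3 \<and>
     is_tree A (pattern_edges A) \<and>
     (\<exists>!Q. top_exit m A Q) \<and> (\<exists>!Q. bottom_exit m A Q) \<and>
     (\<exists>!Q. left_exit m A Q) \<and> (\<exists>!Q. right_exit m A Q) \<and>
     (\<forall>i\<in>{0, m - 1}. \<forall>j\<in>{0, m - 1}.
        grid_square i j m \<in> A \<longrightarrow> grid_square (m - 1 - i) (m - 1 - j) m \<notin> A)"

definition horizontally_blocked :: "nat \<Rightarrow> plane_set set \<Rightarrow> bool" where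
  "horizontally_blocked m A \<longleftrightarrow>
     (\<exists>j<m. left_exit m A (grid_square 0 j m) \<and> right_exit m A (grid_square (m - 1) j m) \<and>
        (\<exists>i<m. grid_square i j m \<in> black m A))"

definition vertically_blocked :: "nat \<Rightarrow> plane_set set \<Rightarrow> bool" where
  "vertically_blocked m A \<longleftrightarrow>
     (\<exists>i<m. top_exit m A (grid_square i (m - 1) m) \<and> bottom_exit m A (grid_square i 0 m) \<and>
        (\<exists>j<m. grid_square i j m \<in> black m A))"

text \<open>The length of a path is the supremum of the lengths of its inscribed polygons.\<close>

definition path_length :: "(real \<Rightarrow> 'a::metric_space) \<Rightarrow> ennreal" where
  "path_length g =
     (SUP ts \<in> {ts. sorted ts \<and> set ts \<subseteq> {0..1}}.
        ennreal (\<Sum>i<length ts - 1. dist (g (ts ! i)) (g (ts ! Suc i))))"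

definition arc_in :: "'a::topological_space set \<Rightarrow> 'a \<Rightarrow> 'a \<Rightarrow> (real \<Rightarrow> 'a) \<Rightarrow> bool" where
  "arc_in L x y g \<longleftrightarrow> arc g \<and> path_image g \<subseteq> L \<and> pathstart g = x \<and> pathfinish g = y"

end

theory Submission
  imports Defs "HOL-Complex_Analysis.Great_Picard"
begin

text \<open>
  The patterns of the sequence are crosses of odd width \<open>m\<close> whose centre is black, with a small hook
  around the centre that connects the four arms into a tree. The black centre blocks the row and the
  column of the exits, yet two exits are connected by at most \<open>m + 4\<close> squares. The blocked
  pattern therefore lengthens a connection between exits only by the factor \<open>1 + 4 / m\<close>, and for widths
  growing like \<open>2 ^ k\<close> the product of these factors converges. So exits are joined by curves whose
  length is bounded uniformly in the level (\<open>joined_exits\<close>). An arbitrary point is joined to an exit by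
  following the sequence of nested squares that contain it; the lengths form a geometric series
  (\<open>joined_to_exit\<close>). By compactness, any two points of the limit set are joined in it by a Lipschitz
  curve (\<open>joined_limit\<close>), and such a curve contains an arc.

  It remains to bound the length of every arc with these end points. The limit set is a union of scaled
  limit sets, of which two meet in at most one point, arranged along a tree. Hence it is an iterated
  wedge, and at each scale two of its points are linked by a chain of points that separate
  them (\<open>finely_cut_limit\<close>). A connected set through the ends of an arc contains
  these chains, and so, if compact, the arc itself (\<open>subarc_subset_connected\<close>). In particular
  the Lipschitz curve runs through the points of any arc with its end points, and it can be seen to visit
  the vertices of each inscribed polygon in their order along the arc, so the length of the arc is at most that of the curve (\<open>path_length_arc_finite\<close>).
\<close>

section \<open>Chains of cut points\<close>

text \<open>Besides \<open>x\<close> and \<open>y\<close> themselves these are the points that separate \<open>x\<close> from \<open>y\<close> in \<open>M\<close>. If no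
  connected subset of \<open>M\<close> joins \<open>x\<close> and \<open>y\<close>, the intersection is over the empty family and every point is a member.\<close>

definition cut_set :: "'a::metric_space set \<Rightarrow> 'a \<Rightarrow> 'a \<Rightarrow> 'a set" where
  "cut_set M x y = \<Inter>{K. K \<subseteq> M \<and> connected K \<and> x \<in> K \<and> y \<in> K}"

abbreviation cut_step :: "real \<Rightarrow> 'a::metric_space set \<Rightarrow> 'a \<Rightarrow> 'a \<Rightarrow> ('a \<times> 'a) set" where
  "cut_step \<epsilon> M x y \<equiv> {(u, v). u \<in> cut_set M x y \<and> v \<in> cut_set M x y \<and> dist u v \<le> \<epsilon>}"

text \<open>In a set that is finely cut at every scale, two points are linked, up to gaps of any prescribed
  size, by points through which every connection between them must pass. This is the form in which
  the uniqueness of arcs in a dendrite is used below.\<close>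

definition finely_cut :: "real \<Rightarrow> 'a::metric_space set \<Rightarrow> bool" where
  "finely_cut \<epsilon> M \<longleftrightarrow> (\<forall>x\<in>M. \<forall>y\<in>M. (x, y) \<in> (cut_step \<epsilon> M x y)\<^sup>*)"

lemma finely_cutD:
  "finely_cut \<epsilon> M \<Longrightarrow> x \<in> M \<Longrightarrow> y \<in> M \<Longrightarrow> (x, y) \<in> (cut_step \<epsilon> M x y)\<^sup>*"
  by (simp add: finely_cut_def)

lemma finely_cut_mono:
  assumes "finely_cut \<delta> M" "\<delta> \<le> \<epsilon>"
  shows "finely_cut \<epsilon> M"
proof -
  have "cut_step \<delta> M x y \<subseteq> cut_step \<epsilon> M x y" for x y
    using assms(2) by auto
  then show ?thesis
    using assms(1) rtrancl_mono unfolding finely_cut_def by blast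
qed

lemma cut_chain_mono:
  assumes "(u, v) \<in> (cut_step \<epsilon> M x y)\<^sup>*" "cut_set M x y \<subseteq> cut_set N x' y'"
  shows "(u, v) \<in> (cut_step \<epsilon> N x' y')\<^sup>*"
proof -
  have "cut_step \<epsilon> M x y \<subseteq> cut_step \<epsilon> N x' y'"
    using assms(2) by auto
  then show ?thesis
    using assms(1) rtrancl_mono by blast
qed

text \<open>The direct jump from \<open>x\<close> to \<open>y\<close> is a chain already; this starts the induction over scales.\<close>

lemma finely_cut_if_dist_le:
  assumes "\<And>x y. x \<in> M \<Longrightarrow> y \<in> M \<Longrightarrow> dist x y \<le> \<epsilon>"
  shows "finely_cut \<epsilon> M"
  unfolding finely_cut_def
proof (intro ballI)
  fix x y assume "x \<in> M" "y \<in> M"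
  then have "(x, y) \<in> cut_step \<epsilon> M x y"
    using assms by (auto simp: cut_set_def)
  then show "(x, y) \<in> (cut_step \<epsilon> M x y)\<^sup>*"
    by blast
qed

lemma connected_meets_wedge_point:
  assumes "closed M" "closed B" "M \<inter> B \<subseteq> {p}" "connected K" "K \<subseteq> M \<union> B"
    and "K \<inter> M \<noteq> {}" "K \<inter> B \<noteq> {}"
  shows "p \<in> K"
proof (rule ccontr)
  assume "p \<notin> K"
  then have "M \<inter> B \<inter> K = {}"
    using assms(3) by auto
  then show False
    using assms connected_closed[of K] by (metis Int_commute)
qed

text \<open>Collapsing \<open>B\<close> to the wedge point is a continuous retraction onto \<open>M\<close>; applied to a connected set
  that meets both parts, and so contains \<open>p\<close>, it yields exactly the part inside \<open>M\<close>.\<close>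

lemma connected_Int_wedge:
  assumes cl: "closed M" "closed B" and MB: "M \<inter> B \<subseteq> {p}" and K: "connected K" "K \<subseteq> M \<union> B"
  shows "connected (K \<inter> M)"
proof (cases "K \<inter> M = {} \<or> K \<subseteq> M")
  case True
  then show ?thesis
    using K(1) by (metis connected_empty inf.absorb1)
next
  case False
  then have "p \<in> K"
    using connected_meets_wedge_point[OF cl MB K] K(2) by blast
  have pM: "p \<in> M \<inter> B"
  proof (rule ccontr)
    assume "p \<notin> M \<inter> B"
    then have "M \<inter> B \<inter> K = {}"
      using MB by auto
    then show False
      using False K cl connected_closed[of K] by (metis Int_commute Un_Int_distrib inf.absorb_iff1 subset_eq IntI UnE empty_iff)
  qed
  let ?r = "\<lambda>z. if z \<in> M then z else p"
  have split: "K = (K \<inter> M) \<union> (K \<inter> B)"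
    using K(2) by blast
  have "continuous_on ((K \<inter> M) \<union> (K \<inter> B)) ?r"
  proof (rule continuous_on_cases_local)
    show "closedin (top_of_set (K \<inter> M \<union> K \<inter> B)) (K \<inter> M)"
      using cl(1) by (metis split closedin_closed_Int)
    show "closedin (top_of_set (K \<inter> M \<union> K \<inter> B)) (K \<inter> B)"
      using cl(2) by (metis split closedin_closed_Int)
  qed (use MB in auto)
  then have "connected (?r ` K)"
    using connected_continuous_image K(1) split by metis
  moreover have "?r ` K = K \<inter> M"
    using \<open>p \<in> K\<close> pM by auto
  ultimately show ?thesis
    by simp
qed

text \<open>Attaching something at a single point creates no way around a cut point: a connection in the wedge
  restricts to one in \<open>M\<close>.\<close>

lemma cut_set_wedge:
  assumes "closed M" "closed B" "M \<inter> B \<subseteq> {p}" "x \<in> M" "y \<in> M"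
  shows "cut_set M x y \<subseteq> cut_set (M \<union> B) x y"
  using connected_Int_wedge[OF assms(1-3)] assms(4,5) unfolding cut_set_def by blast

lemma cut_set_left:
  "p \<in> cut_set M x y \<Longrightarrow> cut_set M x p \<subseteq> cut_set M x y"
  unfolding cut_set_def by blast

lemma cut_set_right:
  "p \<in> cut_set M x y \<Longrightarrow> cut_set M p y \<subseteq> cut_set M x y"
  unfolding cut_set_def by blast

text \<open>Two points of the same part keep their chain; for points in different parts the wedge point is
  itself a cut point, and the chains on its two sides are joined there.\<close>

lemma finely_cut_wedge:
  assumes cl: "closed M" "closed B" and MB: "M \<inter> B = {p}"
    and fM: "finely_cut \<epsilon> M" and fB: "finely_cut \<epsilon> B"
  shows "finely_cut \<epsilon> (M \<union> B)"
proof -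
  have same: "(x, y) \<in> (cut_step \<epsilon> (M \<union> B) x y)\<^sup>*" if "x \<in> M" "y \<in> M" "closed M" "closed B" "M \<inter> B = {p}"
      "finely_cut \<epsilon> M" for x y M B
    by (rule cut_chain_mono[OF finely_cutD[OF that(6) that(1,2)] cut_set_wedge[of M B p]])
      (use that in auto)
  have cross: "(x, y) \<in> (cut_step \<epsilon> (M \<union> B) x y)\<^sup>*" if "x \<in> M" "y \<in> B" "closed M" "closed B" "M \<inter> B = {p}"
      "finely_cut \<epsilon> M" "finely_cut \<epsilon> B" for x y M B
  proof -
    have p: "p \<in> cut_set (M \<union> B) x y"
      using connected_meets_wedge_point[of M B p] that unfolding cut_set_def by blast
    have "(x, p) \<in> (cut_step \<epsilon> (M \<union> B) x y)\<^sup>*"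
      by (rule cut_chain_mono[OF same[of x M p B] cut_set_left[OF p]]) (use that in auto)
    moreover have "(p, y) \<in> (cut_step \<epsilon> (B \<union> M) p y)\<^sup>*"
      using same[of p B y M] that by blast
    then have "(p, y) \<in> (cut_step \<epsilon> (M \<union> B) p y)\<^sup>*"
      by (simp only: Un_commute)
    then have "(p, y) \<in> (cut_step \<epsilon> (M \<union> B) x y)\<^sup>*"
      by (rule cut_chain_mono[OF _ cut_set_right[OF p]])
    ultimately show ?thesis
      by (rule rtrancl_trans)
  qed
  have BM: "B \<inter> M = {p}"
    using MB by auto
  show ?thesis
    unfolding finely_cut_def
  proof (intro ballI)
    fix x y assume "x \<in> M \<union> B" "y \<in> M \<union> B"
    then consider "x \<in> M" "y \<in> M" | "x \<in> M" "y \<in> B" | "x \<in> B" "y \<in> M" | "x \<in> B" "y \<in> B"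
      by blast
    then show "(x, y) \<in> (cut_step \<epsilon> (M \<union> B) x y)\<^sup>*"
    proof cases
      case 1 then show ?thesis using same[OF _ _ cl MB fM] by blast
    next
      case 2 then show ?thesis using cross[OF _ _ cl MB fM fB] by blast
    next
      case 3 then show ?thesis using cross[OF _ _ cl(2,1) BM fB fM] by (simp add: Un_commute)
    next
      case 4 then show ?thesis using same[OF _ _ cl(2,1) BM fB] by (simp add: Un_commute)
    qed
  qed
qed

lemma finely_cut_image:
  assumes f: "\<And>u v. dist (f u) (f v) = q * dist u v" and "q \<ge> 0"
    and g: "\<And>u. g (f u) = u" "\<And>S. continuous_on S g"
    and M: "finely_cut \<epsilon> M"
  shows "finely_cut (q * \<epsilon>) (f ` M)"
proof -
  have cut: "f u \<in> cut_set (f ` M) (f x) (f y)" if "u \<in> cut_set M x y" for u x y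
    unfolding cut_set_def
  proof (intro InterI, safe)
    fix K assume K: "K \<subseteq> f ` M" "connected K" "f x \<in> K" "f y \<in> K"
    have "g ` K \<subseteq> M"
      using K(1) g(1) by auto
    moreover have "connected (g ` K)"
      using K(2) g(2) by (intro connected_continuous_image)
    moreover have "x \<in> g ` K" "y \<in> g ` K"
      using imageI[OF K(3), of g] imageI[OF K(4), of g] g(1) by simp_all
    ultimately have "u \<in> g ` K"
      using that unfolding cut_set_def by blast
    then show "f u \<in> K"
      using K(1) g(1) by auto
  qed
  show ?thesis
    unfolding finely_cut_def
  proof (intro ballI, elim imageE, hypsubst)
    fix x y assume "x \<in> M" "y \<in> M"
    have scale: "(f u, f v) \<in> cut_step (q * \<epsilon>) (f ` M) (f x) (f y)" if "(u, v) \<in> cut_step \<epsilon> M x y" for u v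
      using that cut \<open>q \<ge> 0\<close> by (auto simp: f mult_left_mono)
    have "(f x, f v) \<in> (cut_step (q * \<epsilon>) (f ` M) (f x) (f y))\<^sup>*" if "(x, v) \<in> (cut_step \<epsilon> M x y)\<^sup>*" for v
      using that
    proof (induction rule: rtrancl_induct)
      case (step v w)
      then show ?case
        using scale by (meson rtrancl.rtrancl_into_rtrancl)
    qed simp
    then show "(f x, f y) \<in> (cut_step (q * \<epsilon>) (f ` M) (f x) (f y))\<^sup>*"
      using finely_cutD[OF M \<open>x \<in> M\<close> \<open>y \<in> M\<close>] by blast
  qed
qed

text \<open>If a compact connected set \<open>K\<close> contained \<open>g s\<close> and \<open>g u\<close> but not the intermediate point \<open>g t\<close>, then
  removing \<open>g t\<close> would split \<open>K\<close>'s share of the subarc into two disjoint compact sets, which are some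
  distance \<open>d\<close> apart. A chain of cut points from \<open>g s\<close> to \<open>g u\<close> lies in \<open>K\<close> as well as on the subarc,
  since both are connected, so a chain with gaps smaller than \<open>d\<close> could never cross over.\<close>

lemma subarc_subset_connected:
  fixes g :: "real \<Rightarrow> 'a::heine_borel"
  assumes cut: "\<And>\<epsilon>. \<epsilon> > 0 \<Longrightarrow> finely_cut \<epsilon> L"
    and g: "arc g" "path_image g \<subseteq> L"
    and K: "compact K" "connected K" "K \<subseteq> L"
    and t: "0 \<le> s" "s \<le> t" "t \<le> u" "u \<le> 1" and ends: "g s \<in> K" "g u \<in> K"
  shows "g t \<in> K"
proof (rule ccontr)
  assume no: "g t \<notin> K"
  have cont: "continuous_on {0..1} g" and inj: "inj_on g {0..1}"
    using g(1) by (auto simp: arc_def path_def)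
  have cp: "compact (g ` {c..d})" if "0 \<le> c" "d \<le> 1" for c d
    using that by (intro compact_continuous_image continuous_on_subset[OF cont]) auto
  define G1 G2 where "G1 = g ` {s..t} \<inter> K" and "G2 = g ` {t..u} \<inter> K"
  have "compact G1" "compact G2"
    unfolding G1_def G2_def using cp t K(1) by (auto intro!: compact_Int)
  moreover have "G1 \<inter> G2 = {}"
  proof -
    have "v = w" if "v \<in> {s..t}" "w \<in> {t..u}" "g v = g w" for v w
      using that t inj by (auto simp: inj_on_def)
    then have "v = t" if "v \<in> {s..t}" "w \<in> {t..u}" "g v = g w" for v w
      using that by fastforce
    then show ?thesis
      using no unfolding G1_def G2_def by (auto; metis atLeastAtMost_iff)
  qed
  ultimately obtain d where d: "d > 0" "\<And>v w. v \<in> G1 \<Longrightarrow> w \<in> G2 \<Longrightarrow> d \<le> dist v w"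
    using separate_compact_closed[of G1 G2] compact_imp_closed by metis
  have inK: "cut_set L (g s) (g u) \<subseteq> K"
    using K ends unfolding cut_set_def by blast
  have "connected (g ` {s..u})" "g ` {s..u} \<subseteq> L"
    using g(2) t by (auto simp: path_image_def intro!: connected_continuous_image continuous_on_subset[OF cont])
  then have inG: "cut_set L (g s) (g u) \<subseteq> g ` {s..u}"
    using t unfolding cut_set_def by (intro Inter_lower) auto
  have sub: "cut_set L (g s) (g u) \<subseteq> G1 \<union> G2"
  proof
    fix z assume "z \<in> cut_set L (g s) (g u)"
    then obtain v where "v \<in> {s..u}" "z = g v" "z \<in> K"
      using inK inG by blast
    then show "z \<in> G1 \<union> G2"
      unfolding G1_def G2_def by (cases "v \<le> t") auto
  qed
  have "g s \<in> L" "g u \<in> L"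
    using ends K(3) by auto
  have "z \<in> G1" if "(g s, z) \<in> (cut_step (d/2) L (g s) (g u))\<^sup>*" for z
    using that
  proof (induction rule: rtrancl_induct)
    case base
    then show ?case using t ends by (auto simp: G1_def)
  next
    case (step v w)
    then show ?case
      using sub d(2)[of v w] d(1) by fastforce
  qed
  then have "g u \<in> G1"
    using finely_cutD[OF cut[of "d/2"]] d(1) \<open>g s \<in> L\<close> \<open>g u \<in> L\<close> by auto
  moreover have "g u \<in> G2"
    using t ends by (auto simp: G2_def)
  ultimately show False
    using \<open>G1 \<inter> G2 = {}\<close> by blast
qed

section \<open>Curves of bounded length\<close>

text \<open>Parametrising by an interval of length \<open>C\<close> with Lipschitz constant 1, instead of by the unit interval
  with constant \<open>C\<close>, makes concatenation a mere shift of parameters, and covers \<open>C = 0\<close>.\<close>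

definition joined :: "real \<Rightarrow> 'a::metric_space set \<Rightarrow> 'a \<Rightarrow> 'a \<Rightarrow> bool" where
  "joined C S x y \<longleftrightarrow> C \<ge> 0 \<and> (\<exists>f. 1-lipschitz_on {0..C} f \<and> f ` {0..C} \<subseteq> S \<and> f 0 = x \<and> f C = y)"

text \<open>The arc is compared with a Lipschitz curve \<open>f\<close> having the same ends. Once \<open>f\<close> has reached \<open>g t\<close>, the
  rest of \<open>f\<close> is connected and contains \<open>g t\<close> and \<open>g 1\<close>, so it passes through every later point of the
  arc. Hence \<open>f\<close> visits the vertices of an inscribed polygon in their order along the arc, and the
  parameter it spends between consecutive visits bounds the sides.\<close>

lemma polygon_le_lipschitz:
  fixes g f :: "real \<Rightarrow> 'a::heine_borel"
  assumes cut: "\<And>\<epsilon>. \<epsilon> > 0 \<Longrightarrow> finely_cut \<epsilon> L"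
    and g: "arc g" "path_image g \<subseteq> L"
    and f: "1-lipschitz_on {0..C} f" "f ` {0..C} \<subseteq> L" "f C = g 1"
    and "sorted (t # ts)" "set (t # ts) \<subseteq> {0..1}" "0 \<le> s" "s \<le> C" "f s = g t"
  shows "(\<Sum>i<length ts. dist (g ((t # ts) ! i)) (g ((t # ts) ! Suc i))) \<le> C - s"
  using assms(7-)
proof (induction ts arbitrary: s t)
  case Nil
  then show ?case by simp
next
  case (Cons t1 ts)
  have cont: "continuous_on {s..C} f"
    using lipschitz_on_continuous_on[OF f(1)] Cons.prems(3) by (auto intro: continuous_on_subset)
  have "g t1 \<in> f ` {s..C}"
  proof (rule subarc_subset_connected[OF cut g])
    show "compact (f ` {s..C})" "connected (f ` {s..C})"
      using cont by (auto intro: compact_continuous_image connected_continuous_image)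
    show "f ` {s..C} \<subseteq> L"
      using f(2) Cons.prems by fastforce
    show "0 \<le> t" "t \<le> t1" "t1 \<le> 1" "(1::real) \<le> 1"
      using Cons.prems by auto
    show "g t \<in> f ` {s..C}" "g 1 \<in> f ` {s..C}"
      using Cons.prems f(3) by (auto simp flip: f(3) Cons.prems(5))
  qed
  then obtain s1 where s1: "s \<le> s1" "s1 \<le> C" "f s1 = g t1"
    by auto
  have "dist (g t) (g t1) \<le> s1 - s"
    using lipschitz_onD[OF f(1), of s s1] s1 Cons.prems by (simp add: dist_real_def)
  moreover have "(\<Sum>i<length ts. dist (g ((t1 # ts) ! i)) (g ((t1 # ts) ! Suc i))) \<le> C - s1"
    by (rule Cons.IH) (use Cons.prems s1 in auto)
  moreover have "(\<Sum>i<length (t1 # ts). dist (g ((t # t1 # ts) ! i)) (g ((t # t1 # ts) ! Suc i)))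
      = dist (g t) (g t1) + (\<Sum>i<length ts. dist (g ((t1 # ts) ! i)) (g ((t1 # ts) ! Suc i)))"
    by (simp add: sum.lessThan_Suc_shift del: sum.lessThan_Suc)
  ultimately show ?case
    by linarith
qed

text \<open>A single curve of bounded length between \<open>x\<close> and \<open>y\<close> thus controls every arc between them.\<close>

lemma path_length_arc_finite:
  fixes g :: "real \<Rightarrow> 'a::heine_borel"
  assumes cut: "\<And>\<epsilon>. \<epsilon> > 0 \<Longrightarrow> finely_cut \<epsilon> L"
    and arc: "arc_in L x y g" and "joined C L x y"
  shows "path_length g < \<infinity>"
proof -
  have g: "arc g" "path_image g \<subseteq> L" "g 0 = x" "g 1 = y"
    using arc by (auto simp: arc_in_def pathstart_def pathfinish_def)
  obtain f where f: "1-lipschitz_on {0..C} f" "f ` {0..C} \<subseteq> L" "f 0 = x" "f C = y" "C \<ge> 0"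
    using assms(3) by (auto simp: joined_def)
  have "(\<Sum>i<length ts - 1. dist (g (ts ! i)) (g (ts ! Suc i))) \<le> C"
    if ts: "sorted ts" "set ts \<subseteq> {0..1}" for ts
  proof (cases ts)
    case Nil
    then show ?thesis using f(5) by simp
  next
    case (Cons t us)
    \<comment> \<open>The comparison curve starts at the initial point of the arc, so the parameter 0 is prefixed.\<close>
    have "(\<Sum>i<length ts. dist (g ((0 # ts) ! i)) (g ((0 # ts) ! Suc i))) \<le> C - 0"
      by (rule polygon_le_lipschitz[OF cut g(1,2) f(1,2)]) (use f g ts in auto)
    moreover have "(\<Sum>i<length ts. dist (g ((0 # ts) ! i)) (g ((0 # ts) ! Suc i)))
        = dist (g 0) (g t) + (\<Sum>i<length ts - 1. dist (g (ts ! i)) (g (ts ! Suc i)))"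
      using Cons by (simp add: sum.lessThan_Suc_shift del: sum.lessThan_Suc)
    ultimately show ?thesis
      by (smt (verit) zero_le_dist)
  qed
  then have "path_length g \<le> ennreal C"
    unfolding path_length_def by (intro SUP_least ennreal_leI) blast
  then show ?thesis
    by (simp add: le_less_trans)
qed

lemma joined_mono:
  assumes "joined C S x y" "C \<le> D" "S \<subseteq> T"
  shows "joined D T x y"
proof -
  obtain f where f: "1-lipschitz_on {0..C} f" "f ` {0..C} \<subseteq> S" "f 0 = x" "f C = y" "C \<ge> 0"
    using assms(1) by (auto simp: joined_def)
  have "1-lipschitz_on {0..D} (\<lambda>t. f (min t C))"
  proof (rule lipschitz_onI)
    fix s t assume "s \<in> {0..D}" "t \<in> {0..D}"
    then have "dist (f (min s C)) (f (min t C)) \<le> 1 * dist (min s C) (min t C)"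
      using f(5) by (intro lipschitz_onD[OF f(1)]) auto
    also have "\<dots> \<le> 1 * dist s t"
      by (simp add: dist_real_def)
    finally show "dist (f (min s C)) (f (min t C)) \<le> 1 * dist s t" .
  qed simp
  then show ?thesis
    unfolding joined_def using f assms(2,3)
    by (intro conjI exI[of _ "\<lambda>t. f (min t C)"]) (auto simp: image_subset_iff)
qed

lemma joined_trans:
  assumes "joined C S x y" "joined D S y z"
  shows "joined (C + D) S x z"
proof -
  obtain f where f: "1-lipschitz_on {0..C} f" "f ` {0..C} \<subseteq> S" "f 0 = x" "f C = y" "C \<ge> 0"
    using assms(1) by (auto simp: joined_def)
  obtain h where h: "1-lipschitz_on {0..D} h" "h ` {0..D} \<subseteq> S" "h 0 = y" "h D = z" "D \<ge> 0"
    using assms(2) by (auto simp: joined_def)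
  have "1-lipschitz_on {C..C + D} (\<lambda>t. h (t - C))"
  proof (rule lipschitz_onI)
    fix s t assume "s \<in> {C..C + D}" "t \<in> {C..C + D}"
    then have "dist (h (s - C)) (h (t - C)) \<le> 1 * dist (s - C) (t - C)"
      by (intro lipschitz_onD[OF h(1)]) auto
    then show "dist (h (s - C)) (h (t - C)) \<le> 1 * dist s t"
      by (simp add: dist_real_def)
  qed simp
  then have "1-lipschitz_on {0..C + D} (\<lambda>t. if t \<le> C then f t else h (t - C))"
    using lipschitz_on_concat[OF f(1), of "C + D" "\<lambda>t. h (t - C)"] f h by simp
  then show ?thesis
    unfolding joined_def using f h
    by (intro conjI exI[of _ "\<lambda>t. if t \<le> C then f t else h (t - C)"]) (auto simp: image_subset_iff)
qed

lemma joined_sym: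
  assumes "joined C S x y"
  shows "joined C S y x"
proof -
  obtain f where f: "1-lipschitz_on {0..C} f" "f ` {0..C} \<subseteq> S" "f 0 = x" "f C = y" "C \<ge> 0"
    using assms(1) by (auto simp: joined_def)
  have "1-lipschitz_on {0..C} (\<lambda>t. f (C - t))"
  proof (rule lipschitz_onI)
    fix s t assume "s \<in> {0..C}" "t \<in> {0..C}"
    then have "dist (f (C - s)) (f (C - t)) \<le> 1 * dist (C - s) (C - t)"
      by (intro lipschitz_onD[OF f(1)]) auto
    then show "dist (f (C - s)) (f (C - t)) \<le> 1 * dist s t"
      by (simp add: dist_real_def)
  qed simp
  then show ?thesis
    unfolding joined_def using f
    by (intro conjI exI[of _ "\<lambda>t. f (C - t)"]) (auto simp: image_subset_iff)
qed

lemma joined_image: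
  assumes "joined C S x y" and h: "\<And>u v. dist (h u) (h v) = q * dist u v" and "q > 0"
  shows "joined (q * C) (h ` S) (h x) (h y)"
proof -
  obtain f where f: "1-lipschitz_on {0..C} f" "f ` {0..C} \<subseteq> S" "f 0 = x" "f C = y" "C \<ge> 0"
    using assms(1) by (auto simp: joined_def)
  have in_dom: "t / q \<in> {0..C}" if "t \<in> {0..q * C}" for t
    using that \<open>q > 0\<close> by (auto simp: field_simps)
  have "1-lipschitz_on {0..q * C} (\<lambda>t. h (f (t / q)))"
  proof (rule lipschitz_onI)
    fix s t assume "s \<in> {0..q * C}" "t \<in> {0..q * C}"
    then have "q * dist (f (s / q)) (f (t / q)) \<le> q * (1 * dist (s / q) (t / q))"
      using \<open>q > 0\<close> in_dom by (intro mult_left_mono lipschitz_onD[OF f(1)]) auto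
    also have "\<dots> = dist s t"
      using \<open>q > 0\<close> by (simp add: dist_real_def flip: diff_divide_distrib)
    finally show "dist (h (f (s / q))) (h (f (t / q))) \<le> 1 * dist s t"
      by (simp add: h)
  qed simp
  then show ?thesis
    unfolding joined_def using f \<open>q > 0\<close> in_dom
    by (intro conjI exI[of _ "\<lambda>t. h (f (t / q))"]) (auto simp: image_subset_iff)
qed

lemma joined_convex:
  fixes x y :: "'a::real_normed_vector"
  assumes "convex S" "x \<in> S" "y \<in> S" "dist x y \<le> C"
  shows "joined C S x y"
proof -
  have "joined (dist x y) S x y"
  proof (cases "x = y")
    case True
    then show ?thesis
      using assms by (auto simp: joined_def intro!: exI[of _ "\<lambda>_. x"] lipschitz_intros)
  next
    case False
    define f where "f t = x + (t / dist x y) *\<^sub>R (y - x)" for t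
    have "1-lipschitz_on {0..dist x y} f"
    proof (rule lipschitz_onI)
      fix s t
      have "f s - f t = ((s - t) / dist x y) *\<^sub>R (y - x)"
        unfolding f_def by (simp add: diff_divide_distrib scaleR_left_diff_distrib)
      then have "dist (f s) (f t) = \<bar>s - t\<bar> / dist x y * dist x y"
        by (simp add: dist_norm norm_minus_commute[of y x])
      then show "dist (f s) (f t) \<le> 1 * dist s t"
        using False by (simp add: dist_real_def)
    qed simp
    moreover have "f t \<in> S" if "t \<in> {0..dist x y}" for t
    proof -
      have "f t = (1 - t / dist x y) *\<^sub>R x + (t / dist x y) *\<^sub>R y"
        unfolding f_def by (simp add: scaleR_left_diff_distrib scaleR_right_diff_distrib)
      then show ?thesis
        using that False assms by (auto intro!: convexD)
    qed
    ultimately show ?thesis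
      using False by (auto simp: joined_def f_def intro!: exI[of _ f])
  qed
  then show ?thesis
    using assms(4) joined_mono by blast
qed

text \<open>The curves for the individual \<open>A n\<close> share one Lipschitz constant, so the Arzela-Ascoli theorem gives
  a uniformly convergent subsequence. Its limit inherits the constant, and it lies in every \<open>A k\<close>
  because almost all curves of the subsequence lie in that closed set.\<close>

lemma joined_INT:
  fixes A :: "nat \<Rightarrow> 'a::{real_normed_vector,heine_borel} set"
  assumes "decseq A" and closed: "\<And>n. closed (A n)" and "bounded (A 0)"
    and join: "\<And>n. joined C (A n) x y"
  shows "joined C (\<Inter>n. A n) x y"
proof -
  have "\<exists>f. 1-lipschitz_on {0..C} f \<and> f ` {0..C} \<subseteq> A n \<and> f 0 = x \<and> f C = y" for n
    using join[of n] by (auto simp: joined_def)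
  then obtain F where F: "\<And>n. 1-lipschitz_on {0..C} (F n)" "\<And>n. F n ` {0..C} \<subseteq> A n"
      "\<And>n. F n 0 = x" "\<And>n. F n C = y"
    by metis
  have "C \<ge> 0"
    using join[of 0] by (simp add: joined_def)
  obtain M where M: "\<And>z. z \<in> A 0 \<Longrightarrow> norm z \<le> M"
    using \<open>bounded (A 0)\<close> bounded_iff by metis
  have dec: "A n \<subseteq> A k" if "k \<le> n" for k n
    using \<open>decseq A\<close> that by (simp add: decseq_def)
  obtain f r where f: "continuous_on {0..C} f" "strict_mono (r :: nat \<Rightarrow> nat)"
      "\<And>e. 0 < e \<Longrightarrow> \<exists>N. \<forall>n t. n \<ge> N \<and> t \<in> {0..C} \<longrightarrow> norm (F (r n) t - f t) < e"
  proof (rule Arzela_Ascoli[of "{0..C}" F M])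
    show "norm (F n t) \<le> M" if "t \<in> {0..C}" for n t
      using M F(2) dec that by (metis image_subset_iff le0 subset_eq)
    show "\<exists>d>0. \<forall>n u. u \<in> {0..C} \<and> norm (t - u) < d \<longrightarrow> norm (F n t - F n u) < e"
      if "t \<in> {0..C}" "0 < e" for t e
    proof (intro exI[of _ e] conjI allI impI)
      fix n u assume "u \<in> {0..C} \<and> norm (t - u) < e"
      then show "norm (F n t - F n u) < e"
        using lipschitz_onD[OF F(1) that(1), of u n] by (simp add: dist_norm)
    qed (rule that(2))
  qed auto
  have lim: "(\<lambda>n. F (r n) t) \<longlonglongrightarrow> f t" if "t \<in> {0..C}" for t
    using f(3) that unfolding LIMSEQ_def dist_norm by blast
  have "1-lipschitz_on {0..C} f"
  proof (rule lipschitz_onI)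
    fix s t assume st: "s \<in> {0..C}" "t \<in> {0..C}"
    show "dist (f s) (f t) \<le> 1 * dist s t"
      by (rule LIMSEQ_le_const2[OF tendsto_dist[OF lim[OF st(1)] lim[OF st(2)]]])
        (simp add: lipschitz_onD[OF F(1) st, simplified])
  qed simp
  moreover have "f t \<in> A k" if "t \<in> {0..C}" for t k
  proof (rule Lim_in_closed_set[OF closed _ _ lim[OF that]])
    have "k \<le> r n" if "k \<le> n" for n
      using seq_suble[OF f(2), of n] that by simp
    then have "F (r n) t \<in> A k" if "k \<le> n" for n
      using F(2)[of "r n"] dec[of k "r n"] that \<open>t \<in> {0..C}\<close> by blast
    then show "\<forall>\<^sub>F n in sequentially. F (r n) t \<in> A k"
      unfolding eventually_sequentially by blast
  qed auto
  moreover have "f 0 = x"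
    using LIMSEQ_unique[OF lim[of 0] ] F(3) \<open>C \<ge> 0\<close> by auto
  moreover have "f C = y"
    using LIMSEQ_unique[OF lim[of C] ] F(4) \<open>C \<ge> 0\<close> by auto
  ultimately show ?thesis
    using \<open>C \<ge> 0\<close> unfolding joined_def by blast
qed

lemma joined_imp_arc:
  fixes x :: "'a::{complete_space,real_normed_vector}"
  assumes "joined C L x y" "x \<noteq> y"
  shows "\<exists>g. arc_in L x y g"
proof -
  obtain f where f: "1-lipschitz_on {0..C} f" "f ` {0..C} \<subseteq> L" "f 0 = x" "f C = y" "C \<ge> 0"
    using assms(1) by (auto simp: joined_def)
  define p where "p t = f (C * t)" for t
  have dom: "C * t \<in> {0..C}" if "t \<in> {0..1}" for t
    using that f(5) by (auto intro: mult_left_le)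
  have "path p"
    unfolding path_def p_def
    by (rule continuous_on_compose2[OF lipschitz_on_continuous_on[OF f(1)]])
      (use dom in \<open>auto intro!: continuous_intros\<close>)
  then obtain q where "arc q" "path_image q \<subseteq> path_image p" "pathstart q = x" "pathfinish q = y"
    using path_contains_arc[of p x y] assms(2) f by (auto simp: pathstart_def pathfinish_def p_def)
  moreover have "path_image p \<subseteq> L"
    using dom f(2) by (auto simp: path_image_def p_def)
  ultimately show ?thesis
    unfolding arc_in_def by blast
qed

section \<open>Trees grown leaf by leaf\<close>

lemma is_tree_singleton: "is_tree {v} {}"
  by (auto simp: is_tree_def graph_connected_def graph_cycle_def)

text \<open>A cycle through the new vertex \<open>v\<close> would have two different neighbours of \<open>v\<close> on it, but \<open>u\<close> is the
  only neighbour.\<close>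

lemma is_tree_leaf:
  assumes tree: "is_tree V E" and E: "E \<subseteq> Pow V" and v: "v \<notin> V" and u: "u \<in> V"
  shows "is_tree (insert v V) (insert {u, v} E)"
proof -
  let ?E = "insert {u, v} E"
  let ?R = "{(a, b). {a, b} \<in> E}" and ?R' = "{(a, b). {a, b} \<in> ?E}"
  have "?R\<^sup>* \<subseteq> ?R'\<^sup>*"
    by (intro rtrancl_mono) auto
  then have old: "(a, b) \<in> ?R'\<^sup>*" if "a \<in> V" "b \<in> V" for a b
    using tree that by (auto simp: is_tree_def graph_connected_def)
  have "(u, v) \<in> ?R'" "(v, u) \<in> ?R'"
    by (auto simp: insert_commute)
  then have "(a, v) \<in> ?R'\<^sup>*" "(v, a) \<in> ?R'\<^sup>*" if "a \<in> V" for a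
    using old[OF that u] old[OF u that] by (meson rtrancl.rtrancl_into_rtrancl converse_rtrancl_into_rtrancl)+
  with old have conn: "graph_connected (insert v V) ?E"
    unfolding graph_connected_def by auto
  have "\<not> graph_cycle ?E vs" for vs
  proof
    assume cyc: "graph_cycle ?E vs"
    define n where "n = length vs"
    have n: "n \<ge> 3" "distinct vs" "vs \<noteq> []"
      using cyc by (auto simp: graph_cycle_def n_def)
    have step: "{vs ! i, vs ! Suc i} \<in> ?E" if "Suc i < n" for i
      using cyc that by (simp add: graph_cycle_def n_def)
    have wrap: "{vs ! (n - 1), vs ! 0} \<in> ?E"
      using cyc n(3) by (simp add: graph_cycle_def n_def last_conv_nth hd_conv_nth)
    show False
    proof (cases "v \<in> set vs")
      case False
      have "e \<in> E" if "e \<in> ?E" "e \<subseteq> set vs" for e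
        using that False by auto
      moreover have "{vs ! i, vs ! Suc i} \<subseteq> set vs" if "Suc i < length vs" for i
        using that by simp
      moreover have "{last vs, hd vs} \<subseteq> set vs"
        using n(3) by simp
      ultimately have "graph_cycle E vs"
        using cyc unfolding graph_cycle_def by metis
      then show False
        using tree by (auto simp: is_tree_def)
    next
      case True
      then obtain i where i: "i < n" "vs ! i = v"
        by (auto simp: in_set_conv_nth n_def)
      have only_u: "w = u" if "{v, w} \<in> ?E \<or> {w, v} \<in> ?E" for w
        using that E v by (auto simp: doubleton_eq_iff)
      define j k where "j = (if Suc i < n then Suc i else 0)"
        and "k = (if i = 0 then n - 1 else i - 1)"
      have "{v, vs ! j} \<in> ?E"
      proof (cases "Suc i < n")
        case True
        then show ?thesis
          using step[of i] i(2) by (simp only: j_def if_True)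
      next
        case False
        then have "i = n - 1"
          using i(1) by simp
        then show ?thesis
          using wrap i(2) False by (simp only: j_def if_False)
      qed
      then have "vs ! j = u"
        using only_u by blast
      moreover have "{vs ! k, v} \<in> ?E"
      proof (cases "i = 0")
        case True
        then show ?thesis
          using wrap i(2) by (simp only: k_def simp_thms if_True)
      next
        case False
        then have "Suc (i - 1) = i"
          by simp
        then show ?thesis
          using step[of "i - 1"] i False by (simp only: k_def if_False)
      qed
      then have "vs ! k = u"
        using only_u by blast
      moreover have "j < n" "k < n" "j \<noteq> k"
        using i n(1) by (auto simp: j_def k_def)
      ultimately show False
        using n(2) nth_eq_iff_index_eq unfolding n_def by metis
    qed
  qed
  with conn show ?thesis
    by (auto simp: is_tree_def)
qed

definition adjacent :: "int \<times> int \<Rightarrow> int \<times> int \<Rightarrow> bool" where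
  "adjacent c d \<longleftrightarrow> \<bar>fst c - fst d\<bar> + \<bar>snd c - snd d\<bar> = 1"

lemma adjacent_sym: "adjacent c d \<longleftrightarrow> adjacent d c"
  by (auto simp: adjacent_def)

lemma not_adjacent_self [simp]: "\<not> adjacent c c"
  by (simp add: adjacent_def)

text \<open>A set of lattice points grown by attaching each new point to exactly one neighbour. Such a
  construction serves as the induction principle for three statements: that the pattern graph is a tree,
  that the pieces of the fractal form an iterated wedge, and that short curves run through the pieces.\<close>

inductive leaf_grown :: "(int \<times> int) set \<Rightarrow> bool" where
  single: "leaf_grown {c}"
| leaf: "leaf_grown T \<Longrightarrow> v \<notin> T \<Longrightarrow> u \<in> T \<Longrightarrow> (\<And>w. w \<in> T \<Longrightarrow> adjacent v w \<longleftrightarrow> w = u)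
    \<Longrightarrow> leaf_grown (insert v T)"

section \<open>The pattern\<close>

text \<open>A cross centred at the origin with its centre removed, the inner ends of the four arms being joined by
  a hook around the missing centre that uses all corners of the surrounding ring but \<open>(-1, -1)\<close>.
  The parameters are the lengths by which the left, right, top and bottom arm extend beyond the ring.
  Variable arm lengths are needed because a connection between two exits uses at most two long arms.

  The missing centre blocks the row and the column of the exits at once, and a connection between
  two exits detours around it at the cost of a bounded number of squares.\<close>

definition hooked_cross :: "nat \<Rightarrow> nat \<Rightarrow> nat \<Rightarrow> nat \<Rightarrow> (int \<times> int) set" where
  "hooked_cross l r t b =
     {- int l - 1..-1} \<times> {0} \<union> {1..int r + 1} \<times> {0} \<union>
     {0} \<times> {1..int t + 1} \<union> {0} \<times> {- int b - 1..-1} \<union>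
     {(-1, 1), (1, 1), (1, -1)}"

lemma mem_hooked_cross:
  "(x, y) \<in> hooked_cross l r t b \<longleftrightarrow>
     - int l - 1 \<le> x \<and> x \<le> -1 \<and> y = 0 \<or> 1 \<le> x \<and> x \<le> int r + 1 \<and> y = 0 \<or>
     x = 0 \<and> 1 \<le> y \<and> y \<le> int t + 1 \<or> x = 0 \<and> - int b - 1 \<le> y \<and> y \<le> -1 \<or>
     x = -1 \<and> y = 1 \<or> x = 1 \<and> y = 1 \<or> x = 1 \<and> y = -1"
  by (simp add: hooked_cross_def) blast

lemma hooked_cross_0:
  "hooked_cross 0 0 0 0 = {(0, -1), (1, -1), (1, 0), (1, 1), (0, 1), (-1, 1), (-1, 0)}"
  by (simp add: hooked_cross_def insert_commute)

lemma hooked_cross_Suc: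
  "hooked_cross (Suc l) r t b = insert (- int l - 2, 0) (hooked_cross l r t b)"
  "hooked_cross l (Suc r) t b = insert (int r + 2, 0) (hooked_cross l r t b)"
  "hooked_cross l r (Suc t) b = insert (0, int t + 2) (hooked_cross l r t b)"
  "hooked_cross l r t (Suc b) = insert (0, - int b - 2) (hooked_cross l r t b)"
proof -
  have "{- int (Suc n) - 1..-1} = insert (- int n - 2) {- int n - 1..-1}"
    "{1..int (Suc n) + 1} = insert (int n + 2) {1..int n + 1}" for n
    by auto
  then show "hooked_cross (Suc l) r t b = insert (- int l - 2, 0) (hooked_cross l r t b)"
    "hooked_cross l (Suc r) t b = insert (int r + 2, 0) (hooked_cross l r t b)"
    "hooked_cross l r (Suc t) b = insert (0, int t + 2) (hooked_cross l r t b)"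
    "hooked_cross l r t (Suc b) = insert (0, - int b - 2) (hooked_cross l r t b)"
    unfolding hooked_cross_def by (simp_all only:) blast+
qed

text \<open>The hook is a path, and the arms grow outwards from it one square at a time.\<close>

lemma leaf_grown_hooked_cross: "leaf_grown (hooked_cross l r t b)"
proof -
  have base: "leaf_grown (hooked_cross 0 0 0 0)"
    unfolding hooked_cross_0
    apply (rule leaf[where u = "(1, -1)"])
    apply (rule leaf[where u = "(1, 0)"])
    apply (rule leaf[where u = "(1, 1)"])
    apply (rule leaf[where u = "(0, 1)"])
    apply (rule leaf[where u = "(-1, 1)"])
    apply (rule leaf[where u = "(-1, 0)"])
    by (auto simp: adjacent_def intro: single)
  have 1: "leaf_grown (hooked_cross l 0 0 0)" for l
  proof (induction l)
    case (Suc l)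
    show ?case
      unfolding hooked_cross_Suc
      by (rule leaf[where u = "(- int l - 1, 0)", OF Suc])
        (auto simp: hooked_cross_def adjacent_def)
  qed (rule base)
  have 2: "leaf_grown (hooked_cross l r 0 0)" for l r
  proof (induction r)
    case (Suc r)
    show ?case
      unfolding hooked_cross_Suc
      by (rule leaf[where u = "(int r + 1, 0)", OF Suc])
        (auto simp: hooked_cross_def adjacent_def)
  qed (rule 1)
  have 3: "leaf_grown (hooked_cross l r t 0)" for l r t
  proof (induction t)
    case (Suc t)
    show ?case
      unfolding hooked_cross_Suc
      by (rule leaf[where u = "(0, int t + 1)", OF Suc])
        (auto simp: hooked_cross_def adjacent_def)
  qed (rule 2)
  show ?thesis
  proof (induction b)
    case (Suc b)
    show ?case
      unfolding hooked_cross_Suc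
      by (rule leaf[where u = "(0, - int b - 1)", OF Suc])
        (auto simp: hooked_cross_def adjacent_def)
  qed (rule 3)
qed

lemma card_hooked_cross:
  "finite (hooked_cross l r t b)" "card (hooked_cross l r t b) \<le> 7 + l + r + t + b"
proof -
  have "finite (hooked_cross l r t b) \<and> card (hooked_cross l r t b) \<le> 7 + l + r + t + b"
  proof (induction l)
    case 0
    show ?case
    proof (induction r)
      case 0
      show ?case
      proof (induction t)
        case 0
        show ?case
        proof (induction b)
          case 0
          show ?case by (simp add: hooked_cross_0)
        qed (auto simp: hooked_cross_Suc(4) card_insert_if)
      qed (auto simp: hooked_cross_Suc(3) card_insert_if)
    qed (auto simp: hooked_cross_Suc(2) card_insert_if)
  qed (auto simp: hooked_cross_Suc(1) card_insert_if)
  then show "finite (hooked_cross l r t b)" "card (hooked_cross l r t b) \<le> 7 + l + r + t + b"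
    by auto
qed

lemma square_eq_iff:
  assumes "q > 0" "q' > 0"
  shows "square x y q = square x' y' q' \<longleftrightarrow> x = x' \<and> y = y' \<and> q = q'"
  using assms by (auto simp: square_def times_eq_iff Icc_eq_Icc)

lemma closed_segment_horizontal: "q \<ge> 0 \<Longrightarrow> closed_segment (x, y) (x + q, y) = {x..x + q} \<times> {y :: real}"
  for x :: real
proof -
  assume "q \<ge> 0"
  have "closed_segment (x, y) (x + q, y) = closed_segment x (x + q) \<times> {y}"
    unfolding closed_segment_def by (auto simp: algebra_simps)
  then show ?thesis
    using \<open>q \<ge> 0\<close> by (simp add: closed_segment_eq_real_ivl)
qed

lemma closed_segment_vertical: "q \<ge> 0 \<Longrightarrow> closed_segment (x, y) (x, y + q) = {x :: real} \<times> {y..y + q}"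
  for y :: real
proof -
  assume "q \<ge> 0"
  have "closed_segment (x, y) (x, y + q) = {x} \<times> closed_segment y (y + q)"
    unfolding closed_segment_def by (auto simp: algebra_simps)
  then show ?thesis
    using \<open>q \<ge> 0\<close> by (simp add: closed_segment_eq_real_ivl)
qed

lemma sides_square:
  assumes "q > 0"
  shows "sides (square x y q) =
    {{x..x + q} \<times> {y}, {x..x + q} \<times> {y + q}, {x} \<times> {y..y + q}, {x + q} \<times> {y..y + q}}"
proof -
  have "sides (square x y q) = {closed_segment (x, y) (x + q, y), closed_segment (x, y + q) (x + q, y + q),
          closed_segment (x, y) (x, y + q), closed_segment (x + q, y) (x + q, y + q)}"
    unfolding sides_def using assms by (auto simp: square_eq_iff)
  then show ?thesis
    using assms by (simp add: closed_segment_horizontal closed_segment_vertical)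
qed

lemma sides_meet_iff:
  assumes "q > 0"
  shows "sides (square x y q) \<inter> sides (square x' y' q) \<noteq> {} \<longleftrightarrow>
    x = x' \<and> (y = y' \<or> y = y' + q \<or> y' = y + q) \<or> y = y' \<and> (x = x' + q \<or> x' = x + q)"
proof -
  have hv: "{a..a + q} \<times> {b} \<noteq> {c} \<times> {d..d + q}" "{c} \<times> {d..d + q} \<noteq> {a..a + q} \<times> {b}"
    for a b c d :: real
    using assms by (auto simp: times_eq_iff)
  have hh: "{a..a + q} \<times> {b} = {c..c + q} \<times> {d} \<longleftrightarrow> a = c \<and> b = d" for a b c d :: real
    using assms by (auto simp: times_eq_iff Icc_eq_Icc)
  have vv: "{a} \<times> {b..b + q} = {c} \<times> {d..d + q} \<longleftrightarrow> a = c \<and> b = d" for a b c d :: real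
    using assms by (auto simp: times_eq_iff Icc_eq_Icc)
  show ?thesis
    unfolding sides_square[OF assms]
    by (simp only: Int_insert_right Int_empty_right insert_iff empty_iff hv hh vv if_False
        disj_assoc de_Morgan_disj split: if_split) (use assms in auto)
qed

text \<open>Lattice points are centred, so that \<open>(0, 0)\<close> is the middle square of a grid of odd width \<open>2 * a + 1\<close>.\<close>

definition cell :: "nat \<Rightarrow> int \<times> int \<Rightarrow> plane_set" where
  "cell a c = grid_square (nat (fst c + int a)) (nat (snd c + int a)) (2 * a + 1)"

definition grid_box :: "nat \<Rightarrow> (int \<times> int) set" where
  "grid_box a = {- int a..int a} \<times> {- int a..int a}"

lemma grid_square_eq_square:
  "grid_square i j m = square (real i / real m) (real j / real m) (1 / real m)"
  by (auto simp: grid_square_def square_def add_divide_distrib)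

lemma grid_square_eq_iff:
  "m \<ge> 1 \<Longrightarrow> grid_square i j m = grid_square i' j' m \<longleftrightarrow> i = i' \<and> j = j'"
  by (simp add: grid_square_eq_square square_eq_iff)

lemma cell_eq_square:
  assumes "c \<in> grid_box a"
  shows "cell a c = square ((real_of_int (fst c) + real a) / real (2 * a + 1))
     ((real_of_int (snd c) + real a) / real (2 * a + 1)) (1 / real (2 * a + 1))"
  using assms by (cases c) (auto simp: cell_def grid_square_eq_square grid_box_def)

lemma cell_eq_iff: "c \<in> grid_box a \<Longrightarrow> d \<in> grid_box a \<Longrightarrow> cell a c = cell a d \<longleftrightarrow> c = d"
  by (cases c; cases d) (auto simp: cell_def grid_square_eq_iff grid_box_def)

lemma grid_square_in_cells_iff:
  assumes "T \<subseteq> grid_box a"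
  shows "grid_square i j (2 * a + 1) \<in> cell a ` T \<longleftrightarrow> (int i - int a, int j - int a) \<in> T"
proof
  assume "grid_square i j (2 * a + 1) \<in> cell a ` T"
  then obtain x y where c: "(x, y) \<in> T" "grid_square i j (2 * a + 1) = cell a (x, y)"
    by auto
  then have "int i = x + int a" "int j = y + int a"
    using assms by (auto simp: cell_def grid_square_eq_iff grid_box_def)
  then show "(int i - int a, int j - int a) \<in> T"
    using c(1) by simp
next
  assume "(int i - int a, int j - int a) \<in> T"
  then show "grid_square i j (2 * a + 1) \<in> cell a ` T"
    by (rule rev_image_eqI) (simp add: cell_def)
qed

text \<open>Distinct squares of one grid have a common side exactly when their lattice points are neighbours.
  This turns the pattern graph into the lattice graph.\<close>

lemma cells_share_side_iff:
  assumes "c \<in> grid_box a" "d \<in> grid_box a"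
  shows "cell a c \<noteq> cell a d \<and> sides (cell a c) \<inter> sides (cell a d) \<noteq> {} \<longleftrightarrow> adjacent c d"
proof -
  obtain x y x' y' where cd: "c = (x, y)" "d = (x', y')"
    by (metis surj_pair)
  define m where "m = real (2 * a + 1)"
  have "m > 0"
    by (simp add: m_def)
  have eq: "(real_of_int u + real a) / m = (real_of_int v + real a) / m \<longleftrightarrow> u = v" for u v
    using \<open>m > 0\<close> by simp
  have eq1: "(real_of_int u + real a) / m = (real_of_int v + real a) / m + 1 / m \<longleftrightarrow> u = v + 1" for u v
    using eq[of u "v + 1"] by (simp add: add_divide_distrib)
  have "sides (cell a c) \<inter> sides (cell a d) \<noteq> {} \<longleftrightarrow>
      x = x' \<and> (y = y' \<or> y = y' + 1 \<or> y' = y + 1) \<or> y = y' \<and> (x = x' + 1 \<or> x' = x + 1)"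
    unfolding cell_eq_square[OF assms(1)] cell_eq_square[OF assms(2)] m_def[symmetric]
    using \<open>m > 0\<close> by (subst sides_meet_iff) (simp_all add: cd eq eq1)
  then show ?thesis
    unfolding cell_eq_iff[OF assms] by (auto simp: cd adjacent_def)
qed

lemma pattern_edges_cells:
  assumes "T \<subseteq> grid_box a"
  shows "pattern_edges (cell a ` T) = {{cell a c, cell a d} | c d. c \<in> T \<and> d \<in> T \<and> adjacent c d}"
proof -
  have share: "cell a c \<noteq> cell a d \<and> sides (cell a c) \<inter> sides (cell a d) \<noteq> {} \<longleftrightarrow> adjacent c d"
    if "c \<in> T" "d \<in> T" for c d
    using cells_share_side_iff that assms by (meson subsetD)
  show ?thesis
  proof (intro equalityI subsetI)
    fix e assume "e \<in> pattern_edges (cell a ` T)"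
    then obtain c d where "c \<in> T" "d \<in> T" "e = {cell a c, cell a d}"
        "cell a c \<noteq> cell a d \<and> sides (cell a c) \<inter> sides (cell a d) \<noteq> {}"
      unfolding pattern_edges_def by blast
    then show "e \<in> {{cell a c, cell a d} | c d. c \<in> T \<and> d \<in> T \<and> adjacent c d}"
      using share by blast
  next
    fix e assume "e \<in> {{cell a c, cell a d} | c d. c \<in> T \<and> d \<in> T \<and> adjacent c d}"
    then obtain c d where cd: "c \<in> T" "d \<in> T" "e = {cell a c, cell a d}" "adjacent c d"
      by blast
    then have "cell a c \<noteq> cell a d \<and> sides (cell a c) \<inter> sides (cell a d) \<noteq> {}"
      using share by blast
    then show "e \<in> pattern_edges (cell a ` T)"
      unfolding pattern_edges_def mem_Collect_eq using cd(1-3)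
      by (intro exI[of _ "cell a c"] exI[of _ "cell a d"] conjI imageI) auto
  qed
qed

lemma is_tree_leaf_grown:
  assumes "leaf_grown T" "T \<subseteq> grid_box a"
  shows "is_tree (cell a ` T) (pattern_edges (cell a ` T))"
  using assms
proof (induction rule: leaf_grown.induct)
  case (single c)
  then have "pattern_edges (cell a ` {c}) = {}"
    unfolding pattern_edges_cells[OF single] using not_adjacent_self by blast
  then show ?case
    by (simp add: is_tree_singleton)
next
  case (leaf T v u)
  then have T: "T \<subseteq> grid_box a" and v: "v \<in> grid_box a"
    by auto
  have "pattern_edges (cell a ` insert v T) = insert {cell a u, cell a v} (pattern_edges (cell a ` T))"
    unfolding pattern_edges_cells[OF leaf.prems] pattern_edges_cells[OF T]
  proof (intro equalityI subsetI)
    fix e assume "e \<in> {{cell a c, cell a d} | c d. c \<in> insert v T \<and> d \<in> insert v T \<and> adjacent c d}"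
    then obtain c d where e: "e = {cell a c, cell a d}" "c \<in> insert v T" "d \<in> insert v T" "adjacent c d"
      by blast
    consider "c \<in> T" "d \<in> T" | "c = v" "d \<in> T" | "c \<in> T" "d = v"
      using e(2-4) not_adjacent_self by blast
    then show "e \<in> insert {cell a u, cell a v} {{cell a c, cell a d} | c d. c \<in> T \<and> d \<in> T \<and> adjacent c d}"
    proof cases
      case 1
      then show ?thesis using e by blast
    next
      case 2
      then have "d = u"
        using e(4) leaf.hyps(4) by blast
      then show ?thesis using e(1) 2 by (simp only: insert_commute insertI1)
    next
      case 3
      then have "c = u"
        using e(4) leaf.hyps(4) adjacent_sym by blast
      then show ?thesis using e(1) 3 by (simp only: insertI1)
    qed
  next
    fix e assume "e \<in> insert {cell a u, cell a v} {{cell a c, cell a d} | c d. c \<in> T \<and> d \<in> T \<and> adjacent c d}"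
    moreover have "adjacent u v"
      using leaf.hyps(3,4) adjacent_sym by blast
    then have "{cell a u, cell a v} \<in> {{cell a c, cell a d} | c d. c \<in> insert v T \<and> d \<in> insert v T \<and> adjacent c d}"
      using leaf.hyps(3) by blast
    ultimately show "e \<in> {{cell a c, cell a d} | c d. c \<in> insert v T \<and> d \<in> insert v T \<and> adjacent c d}"
      by blast
  qed
  moreover have "is_tree (insert (cell a v) (cell a ` T)) (insert {cell a u, cell a v} (pattern_edges (cell a ` T)))"
  proof (rule is_tree_leaf[OF leaf.IH[OF T]])
    show "pattern_edges (cell a ` T) \<subseteq> Pow (cell a ` T)"
      by (auto simp: pattern_edges_def)
    show "cell a v \<notin> cell a ` T"
      using cell_eq_iff[OF v] T leaf.hyps(2) by blast
    show "cell a u \<in> cell a ` T"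
      using leaf.hyps(3) by blast
  qed
  ultimately show ?case
    by simp
qed

definition maze :: "nat \<Rightarrow> (int \<times> int) set" where
  "maze a = hooked_cross (a - 1) (a - 1) (a - 1) (a - 1)"

lemma maze_subset_box: "a \<ge> 2 \<Longrightarrow> maze a \<subseteq> grid_box a"
  unfolding maze_def grid_box_def by (auto simp: mem_hooked_cross)

text \<open>Each border row and column of the grid contains a single white square, its middle one. This
  determines the exits, keeps the corners black, and places the exit points of the fractal at the
  midpoints of the sides.\<close>

lemma maze_left_iff: "a \<ge> 2 \<Longrightarrow> (- int a, y) \<in> maze a \<longleftrightarrow> y = 0"
  unfolding maze_def mem_hooked_cross by auto

lemma maze_right_iff: "a \<ge> 2 \<Longrightarrow> (int a, y) \<in> maze a \<longleftrightarrow> y = 0"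
  unfolding maze_def mem_hooked_cross by auto

lemma maze_bottom_iff: "a \<ge> 2 \<Longrightarrow> (x, - int a) \<in> maze a \<longleftrightarrow> x = 0"
  unfolding maze_def mem_hooked_cross by auto

lemma maze_top_iff: "a \<ge> 2 \<Longrightarrow> (x, int a) \<in> maze a \<longleftrightarrow> x = 0"
  unfolding maze_def mem_hooked_cross by auto

lemmas maze_border_iff = maze_left_iff maze_right_iff maze_bottom_iff maze_top_iff

lemma maze_exits:
  assumes "a \<ge> 2"
  defines "m \<equiv> 2 * a + 1"
  shows "left_exit m (cell a ` maze a) Q \<longleftrightarrow> Q = grid_square 0 a m"
    and "right_exit m (cell a ` maze a) Q \<longleftrightarrow> Q = grid_square (m - 1) a m"
    and "bottom_exit m (cell a ` maze a) Q \<longleftrightarrow> Q = grid_square a 0 m"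
    and "top_exit m (cell a ` maze a) Q \<longleftrightarrow> Q = grid_square a (m - 1) m"
proof -
  have mem: "grid_square i j m \<in> cell a ` maze a \<longleftrightarrow> (int i - int a, int j - int a) \<in> maze a" for i j
    unfolding m_def by (rule grid_square_in_cells_iff[OF maze_subset_box[OF assms(1)]])
  have [simp]: "grid_square 0 j m \<in> cell a ` maze a \<longleftrightarrow> j = a"
      "grid_square (m - 1) j m \<in> cell a ` maze a \<longleftrightarrow> j = a"
      "grid_square j 0 m \<in> cell a ` maze a \<longleftrightarrow> j = a"
      "grid_square j (m - 1) m \<in> cell a ` maze a \<longleftrightarrow> j = a" for j
    unfolding mem by (auto simp: m_def maze_border_iff[OF assms(1)])
  have "a < m"
    by (simp add: m_def)
  then show "left_exit m (cell a ` maze a) Q \<longleftrightarrow> Q = grid_square 0 a m"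
    "right_exit m (cell a ` maze a) Q \<longleftrightarrow> Q = grid_square (m - 1) a m"
    "bottom_exit m (cell a ` maze a) Q \<longleftrightarrow> Q = grid_square a 0 m"
    "top_exit m (cell a ` maze a) Q \<longleftrightarrow> Q = grid_square a (m - 1) m"
    unfolding left_exit_def right_exit_def bottom_exit_def top_exit_def
    by (auto simp del: One_nat_def)
qed

lemma maze_labyrinth_pattern:
  assumes "a \<ge> 2"
  shows "labyrinth_pattern (2 * a + 1) (cell a ` maze a)"
    and "horizontally_blocked (2 * a + 1) (cell a ` maze a)"
    and "vertically_blocked (2 * a + 1) (cell a ` maze a)"
proof -
  note box = maze_subset_box[OF assms]
  note mem = grid_square_in_cells_iff[OF box]
  have "cell a ` maze a \<subseteq> grid (2 * a + 1)"
  proof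
    fix Q assume "Q \<in> cell a ` maze a"
    then obtain c where "Q = cell a c" "c \<in> grid_box a"
      using box by blast
    moreover from this have "nat (fst c + int a) < 2 * a + 1" "nat (snd c + int a) < 2 * a + 1"
      by (auto simp: grid_box_def)
    ultimately show "Q \<in> grid (2 * a + 1)"
      unfolding cell_def grid_def by blast
  qed
  moreover have "maze a \<noteq> {}"
    using maze_left_iff[OF assms] by blast
  ultimately have "pattern (2 * a + 1) (cell a ` maze a)"
    by (simp add: pattern_def)
  moreover have "is_tree (cell a ` maze a) (pattern_edges (cell a ` maze a))"
    using is_tree_leaf_grown box leaf_grown_hooked_cross unfolding maze_def by metis
  moreover have "grid_square i j (2 * a + 1) \<notin> cell a ` maze a"
    if "i \<in> {0, 2 * a + 1 - 1}" "j \<in> {0, 2 * a + 1 - 1}" for i j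
    unfolding mem using that assms by (auto simp: maze_border_iff[OF assms])
  ultimately show "labyrinth_pattern (2 * a + 1) (cell a ` maze a)"
    unfolding labyrinth_pattern_def maze_exits[OF assms] using assms by auto
  have "(0, 0) \<notin> maze a"
    by (simp add: maze_def mem_hooked_cross)
  then have "grid_square a a (2 * a + 1) \<notin> cell a ` maze a"
    unfolding mem by simp
  moreover have "a < 2 * a + 1"
    by simp
  moreover from this have "grid_square a a (2 * a + 1) \<in> grid (2 * a + 1)"
    unfolding grid_def by blast
  ultimately have "a < 2 * a + 1" "grid_square a a (2 * a + 1) \<in> black (2 * a + 1) (cell a ` maze a)"
    unfolding black_def by blast+
  then show "horizontally_blocked (2 * a + 1) (cell a ` maze a)"
    "vertically_blocked (2 * a + 1) (cell a ` maze a)"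
    unfolding horizontally_blocked_def vertically_blocked_def maze_exits[OF assms]
    by blast+
qed

section \<open>Unions of pieces along a tree\<close>

text \<open>When a leaf is attached, its piece meets the union of the earlier pieces only inside the piece of its
  unique neighbour, that is, in one point; so the union is an iterated wedge.\<close>

lemma finely_cut_leaf_grown:
  assumes "leaf_grown T" "\<And>c. closed (P c)" "\<And>c. finely_cut \<epsilon> (P c)"
    and disj: "\<And>c d. c \<in> T \<Longrightarrow> d \<in> T \<Longrightarrow> c \<noteq> d \<Longrightarrow> \<not> adjacent c d \<Longrightarrow> P c \<inter> P d = {}"
    and meet: "\<And>c d. c \<in> T \<Longrightarrow> d \<in> T \<Longrightarrow> adjacent c d \<Longrightarrow> \<exists>p. P c \<inter> P d = {p}"
  shows "closed (\<Union>c\<in>T. P c) \<and> finely_cut \<epsilon> (\<Union>c\<in>T. P c)"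
  using assms(1) disj meet
proof (induction rule: leaf_grown.induct)
  case (single c)
  then show ?case
    using assms(2,3) by simp
next
  case (leaf T v u)
  have IH: "closed (\<Union>c\<in>T. P c)" "finely_cut \<epsilon> (\<Union>c\<in>T. P c)"
    using leaf.IH leaf.prems by auto
  have "adjacent u v"
    using leaf.hyps(3,4) adjacent_sym by blast
  then obtain p where p: "P u \<inter> P v = {p}"
    using leaf.prems(2)[of u v] leaf.hyps(3) by auto
  have "P w \<inter> P v = {}" if "w \<in> T" "w \<noteq> u" for w
  proof -
    have "\<not> adjacent w v"
      using leaf.hyps(4)[OF that(1)] that(2) adjacent_sym by blast
    moreover have "w \<noteq> v"
      using leaf.hyps(2) that(1) by blast
    ultimately show ?thesis
      using leaf.prems(1)[of w v] that(1) by blast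
  qed
  then have "(\<Union>c\<in>T. P c) \<inter> P v = {p}"
    using p leaf.hyps(3) by blast
  then have "finely_cut \<epsilon> ((\<Union>c\<in>T. P c) \<union> P v)"
    by (rule finely_cut_wedge[OF IH(1) assms(2) _ IH(2) assms(3)])
  then show ?case
    using IH(1) assms(2)[of v] by (simp add: Un_commute closed_Un)
qed

text \<open>Here \<open>Q c\<close> is a piece and \<open>X c\<close> its set of exits. A route between exits enters every piece at most once,
  at cost \<open>\<beta>\<close>. Counting all pieces of \<open>T\<close> is wasteful in general, but costs only a bounded excess
  when \<open>T\<close> is the route and a few more squares.\<close>

lemma joined_leaf_grown:
  assumes "leaf_grown T" "\<beta> \<ge> 0"
    and step: "\<And>c e e'. c \<in> T \<Longrightarrow> e \<in> X c \<Longrightarrow> e' \<in> X c \<Longrightarrow> joined \<beta> (Q c) e e'"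
    and meet: "\<And>c d. c \<in> T \<Longrightarrow> d \<in> T \<Longrightarrow> adjacent c d \<Longrightarrow> X c \<inter> X d \<noteq> {}"
  shows "finite T \<and> (\<forall>c\<in>T. \<forall>d\<in>T. \<forall>e\<in>X c. \<forall>e'\<in>X d. joined (real (card T) * \<beta>) (\<Union>c\<in>T. Q c) e e')"
  using assms(1) step meet
proof (induction rule: leaf_grown.induct)
  case (single c)
  then show ?case
    by simp
next
  case (leaf T v u)
  let ?n = "real (card (insert v T)) * \<beta>" and ?S = "\<Union>c\<in>insert v T. Q c"
  have IH: "finite T" "\<And>c d e e'. c \<in> T \<Longrightarrow> d \<in> T \<Longrightarrow> e \<in> X c \<Longrightarrow> e' \<in> X d \<Longrightarrow>
      joined (real (card T) * \<beta>) (\<Union>c\<in>T. Q c) e e'"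
    using leaf.IH leaf.prems by auto
  have n: "?n = \<beta> + real (card T) * \<beta>"
    using IH(1) leaf.hyps(2) by (simp add: algebra_simps)
  have "0 \<le> real (card T) * \<beta>"
    using \<open>\<beta> \<ge> 0\<close> by simp
  have v: "joined \<beta> ?S e e'" if "e \<in> X v" "e' \<in> X v" for e e'
    using joined_mono[OF leaf.prems(1)[of v, OF _ that], of \<beta> ?S] by auto
  have T: "joined (real (card T) * \<beta>) ?S e e'" if "c \<in> T" "d \<in> T" "e \<in> X c" "e' \<in> X d" for c d e e'
    using joined_mono[OF IH(2)[OF that], of "real (card T) * \<beta>" ?S] by auto
  have "adjacent v u"
    using leaf.hyps(3,4) by blast
  then obtain p where p: "p \<in> X v" "p \<in> X u"
    using leaf.prems(2)[of v u] leaf.hyps(3) by blast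
  have vT: "joined ?n ?S e e'" if "d \<in> T" "e \<in> X v" "e' \<in> X d" for d e e'
    unfolding n using joined_trans[OF v[OF that(2) p(1)] T[OF leaf.hyps(3) that(1) p(2) that(3)]] .
  have vv: "joined ?n ?S e e'" if "e \<in> X v" "e' \<in> X v" for e e'
    using joined_mono[OF v[OF that], of ?n ?S] \<open>0 \<le> real (card T) * \<beta>\<close> unfolding n by simp
  have TT: "joined ?n ?S e e'" if "c \<in> T" "d \<in> T" "e \<in> X c" "e' \<in> X d" for c d e e'
    using joined_mono[OF T[OF that], of ?n ?S] \<open>\<beta> \<ge> 0\<close> unfolding n by simp
  show ?case
  proof (intro conjI ballI)
    show "finite (insert v T)"
      using IH(1) by simp
    fix c d e e' assume "c \<in> insert v T" "d \<in> insert v T" "e \<in> X c" "e' \<in> X d"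
    then show "joined ?n ?S e e'"
      using vT vv TT joined_sym[OF vT] by (elim insertE) auto
  qed
qed

section \<open>The self-similar structure of the limit set\<close>

text \<open>The pattern of index \<open>k\<close> has width \<open>m = 16 * 2 ^ k + 1\<close>. Doubling the widths gives the estimate
  \<open>(1 + 4 / m) * (1 + 1 / 2 ^ (k + 1)) \<le> 1 + 1 / 2 ^ k\<close>, which makes the product of the relative
  detours \<open>1 + 4 / m\<close> converge.\<close>

definition half_width :: "nat \<Rightarrow> nat" where
  "half_width k = 8 * 2 ^ k"

lemma half_width_ge: "8 \<le> half_width k"
  by (simp add: half_width_def)

lemma half_width_ge2: "2 \<le> half_width k"
  using half_width_ge[of k] by linarith

definition place :: "nat \<Rightarrow> int \<times> int \<Rightarrow> real \<times> real \<Rightarrow> real \<times> real" where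
  "place a c = rescale ((real_of_int (fst c) + real a) / real (2 * a + 1))
     ((real_of_int (snd c) + real a) / real (2 * a + 1)) (1 / real (2 * a + 1))"

definition unit_square :: plane_set where
  "unit_square = {0..1} \<times> {0..1}"

lemma rescale_unit_square: "q > 0 \<Longrightarrow> rescale x y q ` unit_square = square x y q"
proof -
  assume q: "q > 0"
  show ?thesis
  proof (intro equalityI subsetI)
    fix z assume "z \<in> square x y q"
    then have "((fst z - x) / q, (snd z - y) / q) \<in> unit_square" "z = rescale x y q ((fst z - x) / q, (snd z - y) / q)"
      using q by (auto simp: square_def unit_square_def rescale_def field_simps)
    then show "z \<in> rescale x y q ` unit_square"
      by (rule rev_image_eqI)
  qed (use q in \<open>auto simp: square_def unit_square_def rescale_def mult_left_le\<close>)
qed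

lemma place_eq:
  "place a c z = ((real_of_int (fst c) + real a + fst z) / real (2 * a + 1),
     (real_of_int (snd c) + real a + snd z) / real (2 * a + 1))"
  by (simp add: place_def rescale_def add_divide_distrib)

lemma cell_eq_place: "c \<in> grid_box a \<Longrightarrow> cell a c = place a c ` unit_square"
  by (simp add: cell_eq_square place_def rescale_unit_square)

lemma rescale_altdef: "rescale x y q z = (x, y) + q *\<^sub>R z"
  by (cases z) (simp add: rescale_def)

lemma dist_place: "dist (place a c u) (place a c v) = 1 / real (2 * a + 1) * dist u v"
  unfolding place_def rescale_altdef by (simp add: dist_norm flip: scaleR_diff_right)

lemma inj_place: "inj (place a c)"
  using dist_place[of a c] by (intro injI) (metis dist_eq_0_iff mult_eq_0_iff divide_eq_0_iff of_nat_eq_0_iff one_neq_zero add_is_0)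

lemma continuous_on_place: "continuous_on S (place a c)"
  unfolding place_def rescale_altdef by (intro continuous_intros)

lemma place_in_unit_square:
  assumes "c \<in> grid_box a" "z \<in> unit_square"
  shows "place a c z \<in> unit_square"
proof -
  obtain i j x y where "c = (i, j)" "z = (x, y)" "-real a \<le> of_int i" "of_int i \<le> real a"
      "-real a \<le> of_int j" "of_int j \<le> real a" "0 \<le> x" "x \<le> 1" "0 \<le> y" "y \<le> 1"
    using assms by (cases c; cases z) (auto simp: grid_box_def unit_square_def)
  then show ?thesis
    by (auto simp: place_eq unit_square_def)
qed

text \<open>The approximations to the fractal built from the patterns with indices \<open>k\<close>, \<open>k + 1\<close>, and so on. The
  recursion puts the coarsest pattern first, so that an approximation visibly consists of scaled
  approximations for the shifted sequence; the agreement with the recursion that refines the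
  finest squares is shown at the end.\<close>

fun approx :: "nat \<Rightarrow> nat \<Rightarrow> plane_set" where
  "approx k 0 = unit_square"
| "approx k (Suc n) = (\<Union>c\<in>maze (half_width k). place (half_width k) c ` approx (Suc k) n)"

definition limit :: "nat \<Rightarrow> plane_set" where
  "limit k = (\<Inter>n. approx k n)"

lemma maze_in_box: "c \<in> maze (half_width k) \<Longrightarrow> c \<in> grid_box (half_width k)"
  using maze_subset_box[OF half_width_ge2] by blast

lemma finite_maze: "finite (maze a)"
  unfolding maze_def by (rule card_hooked_cross)

lemma compact_approx: "compact (approx k n)"
  by (induction n arbitrary: k)
    (auto simp: unit_square_def finite_maze intro!: compact_Times compact_UN compact_continuous_image continuous_on_place)

lemma approx_subset_unit_square: "approx k n \<subseteq> unit_square"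
proof (induction n arbitrary: k)
  case (Suc n)
  then show ?case
    using place_in_unit_square maze_in_box by (auto simp: subset_eq)
qed simp

lemma approx_Suc_subset: "approx k (Suc n) \<subseteq> approx k n"
proof (induction n arbitrary: k)
  case 0
  show ?case
    using approx_subset_unit_square[of k "Suc 0"] by simp
next
  case (Suc n)
  have "approx (Suc k) (Suc n) \<subseteq> approx (Suc k) n"
    by (rule Suc)
  then show ?case
    unfolding approx.simps(2)[of k] by (intro UN_mono image_mono subset_refl)
qed

lemma decseq_approx: "decseq (approx k)"
  by (intro decseq_SucI approx_Suc_subset)

lemma closed_limit: "closed (limit k)"
  unfolding limit_def using compact_approx by (auto intro: compact_imp_closed)

lemma limit_subset_approx: "limit k \<subseteq> approx k n"
  unfolding limit_def by blast

lemma limit_subset_unit_square: "limit k \<subseteq> unit_square"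
  using limit_subset_approx[of k 0] by simp

text \<open>Union and intersection commute because the approximations decrease and the pattern is finite: if \<open>z\<close>
  dropped out of every piece at some stage, it would have dropped out of all of them at the latest one.\<close>

lemma limit_unfold: "limit k = (\<Union>c\<in>maze (half_width k). place (half_width k) c ` limit (Suc k))"
proof (intro equalityI subsetI)
  fix z assume z: "z \<in> limit k"
  let ?M = "maze (half_width k)" and ?P = "\<lambda>c. place (half_width k) c"
  have "\<exists>c\<in>?M. \<forall>n. z \<in> ?P c ` approx (Suc k) n"
  proof (rule ccontr)
    assume "\<not> (\<exists>c\<in>?M. \<forall>n. z \<in> ?P c ` approx (Suc k) n)"
    then obtain f where f: "\<And>c. c \<in> ?M \<Longrightarrow> z \<notin> ?P c ` approx (Suc k) (f c)"
      by metis
    define N where "N = Max (insert 0 (f ` ?M))"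
    have "z \<notin> ?P c ` approx (Suc k) N" if "c \<in> ?M" for c
    proof -
      have "f c \<le> N"
        using that by (auto simp: N_def finite_maze)
      then have "approx (Suc k) N \<subseteq> approx (Suc k) (f c)"
        using decseq_approx by (simp add: decseq_def)
      then show ?thesis
        using f[OF that] by blast
    qed
    then have "z \<notin> approx k (Suc N)"
      by simp
    then show False
      using z limit_subset_approx by blast
  qed
  then obtain c where c: "c \<in> ?M" "\<And>n. z \<in> ?P c ` approx (Suc k) n"
    by blast
  then have "z \<in> (\<Inter>n. ?P c ` approx (Suc k) n)"
    by blast
  also have "\<dots> = ?P c ` limit (Suc k)"
    unfolding limit_def using image_INT[OF inj_place, of UNIV "approx (Suc k)" 0 "half_width k" c] by simp
  finally show "z \<in> (\<Union>c\<in>?M. ?P c ` limit (Suc k))"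
    using c(1) by blast
next
  fix z assume "z \<in> (\<Union>c\<in>maze (half_width k). place (half_width k) c ` limit (Suc k))"
  then have "z \<in> approx k (Suc n)" for n
    using limit_subset_approx by fastforce
  then have "z \<in> approx k n" for n
    using approx_Suc_subset by blast
  then show "z \<in> limit k"
    by (simp add: limit_def)
qed

section \<open>Exits and doorways\<close>

definition exits :: "(real \<times> real) set" where
  "exits = {(0, 1/2), (1, 1/2), (1/2, 0), (1/2, 1)}"

lemma place_exit:
  "place a (- int a, 0) (0, 1/2) = (0, 1/2)" "place a (int a, 0) (1, 1/2) = (1, 1/2)"
  "place a (0, - int a) (1/2, 0) = (1/2, 0)" "place a (0, int a) (1/2, 1) = (1/2, 1)"
  by (auto simp: place_eq field_simps)

text \<open>Each exit is a fixed point of the map onto the border square that contains it.\<close>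

lemma exits_subset_approx: "exits \<subseteq> approx k n"
proof (induction n arbitrary: k)
  case 0
  show ?case
    by (auto simp: exits_def unit_square_def)
next
  case (Suc n)
  let ?a = "half_width k"
  show ?case
  proof
    fix e assume e: "e \<in> exits"
    have "(- int ?a, 0) \<in> maze ?a" "(int ?a, 0) \<in> maze ?a" "(0, - int ?a) \<in> maze ?a" "(0, int ?a) \<in> maze ?a"
      by (simp_all add: maze_border_iff[OF half_width_ge2])
    then obtain c where c: "c \<in> maze ?a" "place ?a c e = e"
      using e place_exit[of ?a] unfolding exits_def by blast
    have "e \<in> approx (Suc k) n"
      using Suc[of "Suc k"] e by blast
    then have "e \<in> place ?a c ` approx (Suc k) n"
      using imageI[of e "approx (Suc k) n" "place ?a c"] c(2) by simp
    then show "e \<in> approx k (Suc n)"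
      using c(1) by auto
  qed
qed

lemma exits_subset_limit: "exits \<subseteq> limit k"
  unfolding limit_def using exits_subset_approx by blast

text \<open>A point on a side of the unit square lies in the middle square on that side, and on the corresponding
  side of it; every level therefore divides its distance from the midpoint by at least 5.\<close>

lemma border_approx:
  assumes "z \<in> approx k n"
  shows "(fst z = 0 \<or> fst z = 1 \<longrightarrow> \<bar>snd z - 1/2\<bar> \<le> (1/5) ^ n) \<and>
    (snd z = 0 \<or> snd z = 1 \<longrightarrow> \<bar>fst z - 1/2\<bar> \<le> (1/5) ^ n)"
  using assms
proof (induction n arbitrary: k z)
  case 0
  then show ?case
    by (cases z) (auto simp: unit_square_def abs_le_iff)
next
  case (Suc n)
  let ?a = "half_width k"
  obtain i j z' where c: "(i, j) \<in> maze ?a" and z': "z' \<in> approx (Suc k) n" and z: "z = place ?a (i, j) z'"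
    using Suc.prems by auto
  obtain x y where xy: "z' = (x, y)" "0 \<le> x" "x \<le> 1" "0 \<le> y" "y \<le> 1"
    using z' approx_subset_unit_square[of "Suc k" n] by (cases z') (auto simp: unit_square_def subset_eq)
  have ij: "- int ?a \<le> i" "i \<le> int ?a" "- int ?a \<le> j" "j \<le> int ?a"
    using maze_in_box[OF c] by (auto simp: grid_box_def)
  have IH: "x = 0 \<or> x = 1 \<Longrightarrow> \<bar>y - 1/2\<bar> \<le> (1/5) ^ n" "y = 0 \<or> y = 1 \<Longrightarrow> \<bar>x - 1/2\<bar> \<le> (1/5) ^ n"
    using Suc.IH[OF z'] xy(1) by auto
  have ends: "s = 0 \<and> h = - int ?a" if "(real_of_int h + real ?a + s) / real (2 * ?a + 1) = 0"
      "0 \<le> s" "- int ?a \<le> h" for s h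
  proof -
    have "real_of_int h + real ?a + s = 0"
      using that(1) by (simp add: field_simps)
    moreover have "real_of_int (h + int ?a) \<ge> 0"
      using that(3) by (subst of_int_0_le_iff) simp
    ultimately have "s = 0" "real_of_int (h + int ?a) = 0"
      using that(2) by auto
    then show ?thesis
      by (simp only: of_int_eq_0_iff) auto
  qed
  have ends': "s = 1 \<and> h = int ?a" if "(real_of_int h + real ?a + s) / real (2 * ?a + 1) = 1"
      "s \<le> 1" "h \<le> int ?a" for s h
  proof -
    have "real_of_int h + real ?a + s = real (2 * ?a + 1)"
      using that(1) by (subst (asm) divide_eq_1_iff) auto
    moreover have "real_of_int (int ?a - h) \<ge> 0"
      using that(3) by (subst of_int_0_le_iff) simp
    ultimately have "s = 1" "real_of_int (int ?a - h) = 0"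
      using that(2) by auto
    then show ?thesis
      by (simp only: of_int_eq_0_iff) auto
  qed
  have shrink: "\<bar>(real ?a + s) / real (2 * ?a + 1) - 1/2\<bar> \<le> (1/5) ^ Suc n" if "\<bar>s - 1/2\<bar> \<le> (1/5) ^ n" for s
  proof -
    have "(real ?a + s) / real (2 * ?a + 1) - 1/2 = (s - 1/2) / real (2 * ?a + 1)"
      by (simp add: field_simps)
    then have "\<bar>(real ?a + s) / real (2 * ?a + 1) - 1/2\<bar> = \<bar>s - 1/2\<bar> / real (2 * ?a + 1)"
      by simp
    also have "\<dots> \<le> (1/5) ^ n / 5"
      using that half_width_ge[of k] by (intro frac_le) auto
    finally show ?thesis
      by simp
  qed
  note border = maze_border_iff[OF half_width_ge2[of k]]
  show ?case
  proof (intro conjI impI)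
    assume "fst z = 0 \<or> fst z = 1"
    then have "(x = 0 \<and> i = - int ?a) \<or> (x = 1 \<and> i = int ?a)"
      using ends[of i x] ends'[of i x] xy ij by (auto simp: z place_eq)
    then have "j = 0" "x = 0 \<or> x = 1"
      using c border by auto
    then show "\<bar>snd z - 1/2\<bar> \<le> (1/5) ^ Suc n"
      using shrink[OF IH(1)] xy by (simp add: z place_eq)
  next
    assume "snd z = 0 \<or> snd z = 1"
    then have "(y = 0 \<and> j = - int ?a) \<or> (y = 1 \<and> j = int ?a)"
      using ends[of j y] ends'[of j y] xy ij by (auto simp: z place_eq)
    then have "i = 0" "y = 0 \<or> y = 1"
      using c border by auto
    then show "\<bar>fst z - 1/2\<bar> \<le> (1/5) ^ Suc n"
      using shrink[OF IH(2)] xy by (simp add: z place_eq)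
  qed
qed

lemma limit_border:
  assumes "z \<in> limit k"
  shows "fst z = 0 \<or> fst z = 1 \<Longrightarrow> snd z = 1/2" "snd z = 0 \<or> snd z = 1 \<Longrightarrow> fst z = 1/2"
proof -
  have zero: "t = 0" if "\<And>n. \<bar>t\<bar> \<le> (1/5) ^ n" for t :: real
  proof -
    have "(\<lambda>n. (1/5::real) ^ n) \<longlonglongrightarrow> 0"
      by (rule LIMSEQ_power_zero) simp
    then have "\<bar>t\<bar> \<le> 0"
      by (rule LIMSEQ_le_const) (use that in blast)
    then show ?thesis
      by simp
  qed
  have b: "(fst z = 0 \<or> fst z = 1 \<longrightarrow> \<bar>snd z - 1/2\<bar> \<le> (1/5) ^ n) \<and>
    (snd z = 0 \<or> snd z = 1 \<longrightarrow> \<bar>fst z - 1/2\<bar> \<le> (1/5) ^ n)" for n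
    by (rule border_approx[of z k]) (use assms limit_subset_approx in blast)
  show "snd z = 1/2" if "fst z = 0 \<or> fst z = 1"
    using zero[of "snd z - 1/2"] b that by auto
  show "fst z = 1/2" if "snd z = 0 \<or> snd z = 1"
    using zero[of "fst z - 1/2"] b that by auto
qed

text \<open>For neighbours \<open>c\<close> and \<open>d\<close> this is the midpoint of the common side of their squares, computed as the
  image of that exit of the unit square which faces from \<open>c\<close> towards \<open>d\<close>.\<close>

definition doorway :: "nat \<Rightarrow> int \<times> int \<Rightarrow> int \<times> int \<Rightarrow> real \<times> real" where
  "doorway a c d = place a c ((1 + real_of_int (fst d - fst c)) / 2, (1 + real_of_int (snd d - snd c)) / 2)"

lemma doorway_exit:
  assumes "adjacent c d"
  shows "doorway a c d \<in> place a c ` exits" "doorway a c d \<in> place a d ` exits"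
proof -
  have comm: "doorway a c d = doorway a d c"
    by (auto simp: doorway_def place_eq field_simps)
  have mem: "doorway a c d \<in> place a c ` exits" if "adjacent c d" for c d
  proof -
    obtain i j i' j' where cd: "c = (i, j)" "d = (i', j')"
      by (metis surj_pair)
    have "i' = i \<and> (j' = j + 1 \<or> j' = j - 1) \<or> j' = j \<and> (i' = i + 1 \<or> i' = i - 1)"
      using that by (auto simp: cd adjacent_def)
    then have "((1 + real_of_int (fst d - fst c)) / 2, (1 + real_of_int (snd d - snd c)) / 2) \<in> exits"
      by (auto simp: cd exits_def)
    then show ?thesis
      unfolding doorway_def by blast
  qed
  show "doorway a c d \<in> place a c ` exits" "doorway a c d \<in> place a d ` exits"
    using mem assms adjacent_sym comm by (blast, metis)
qed

text \<open>Two squares of the grid overlap only in border points of both, where the fractal has just the exits;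
  an exit of one square is an exit of the other only for squares with a common side.\<close>

lemma places_meet:
  assumes "c \<noteq> d" "z \<in> limit k" "z' \<in> limit k" "place a c z = place a d z'"
  shows "adjacent c d" "place a c z = doorway a c d"
proof -
  obtain i j i' j' x y x' y' where cd: "c = (i, j)" "d = (i', j')" "z = (x, y)" "z' = (x', y')"
    by (metis surj_pair)
  have bounds: "0 \<le> x" "x \<le> 1" "0 \<le> y" "y \<le> 1" "0 \<le> x'" "x' \<le> 1" "0 \<le> y'" "y' \<le> 1"
    using subsetD[OF limit_subset_unit_square assms(2)] subsetD[OF limit_subset_unit_square assms(3)]
    by (auto simp: cd unit_square_def)
  have eq: "real_of_int (i' - i) = x - x'" "real_of_int (j' - j) = y - y'"
    using assms(4) by (auto simp: cd place_eq)
  have int: "h \<in> {-1, 0, 1}" if "real_of_int h = s - t" "0 \<le> s" "s \<le> 1" "0 \<le> t" "t \<le> 1" for h s t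
  proof -
    have "real_of_int h \<le> real_of_int 1" "real_of_int (-1) \<le> real_of_int h"
      using that by auto
    then have "h \<le> 1" "-1 \<le> h"
      by (simp_all only: of_int_le_iff)
    then show ?thesis
      by auto
  qed
  have hx: "i' - i \<in> {-1, 0, 1}" and hy: "j' - j \<in> {-1, 0, 1}"
    using int eq bounds by blast+
  have bz: "x = 0 \<or> x = 1 \<Longrightarrow> y = 1/2" "y = 0 \<or> y = 1 \<Longrightarrow> x = 1/2"
      "x' = 0 \<or> x' = 1 \<Longrightarrow> y' = 1/2" "y' = 0 \<or> y' = 1 \<Longrightarrow> x' = 1/2"
    using limit_border[OF assms(2)] limit_border[OF assms(3)] by (auto simp: cd)
  have cases: "i' - i = 0 \<and> (j' - j = 1 \<or> j' - j = -1) \<and> x = 1/2 \<and> y = (1 + real_of_int (j' - j)) / 2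
      \<or> j' - j = 0 \<and> (i' - i = 1 \<or> i' - i = -1) \<and> y = 1/2 \<and> x = (1 + real_of_int (i' - i)) / 2"
  proof -
    have step: "s = 1 \<and> t = 0" if "h = 1" "real_of_int h = s - t" "s \<le> 1" "0 \<le> t" for h s t
    proof -
      have "s - t = 1"
        using that(1,2) by simp
      then show ?thesis
        using that(3,4) by linarith
    qed
    have step': "s = 0 \<and> t = 1" if "h = -1" "real_of_int h = s - t" "0 \<le> s" "t \<le> 1" for h s t
    proof -
      have "s - t = -1"
        using that(1,2) by simp
      then show ?thesis
        using that(3,4) by linarith
    qed
    have X: "i' - i = 1 \<Longrightarrow> x = 1 \<and> x' = 0" "i' - i = -1 \<Longrightarrow> x = 0 \<and> x' = 1"
      using step[OF _ eq(1)] step'[OF _ eq(1)] bounds by blast+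
    have Y: "j' - j = 1 \<Longrightarrow> y = 1 \<and> y' = 0" "j' - j = -1 \<Longrightarrow> y = 0 \<and> y' = 1"
      using step[OF _ eq(2)] step'[OF _ eq(2)] bounds by blast+
    have ne: "i' - i \<noteq> 0 \<or> j' - j \<noteq> 0"
      using assms(1) by (auto simp: cd)
    consider "i' - i = 1" | "i' - i = -1" | "i' - i = 0" "j' - j = 1" | "i' - i = 0" "j' - j = -1"
      using hx hy ne by blast
    then show ?thesis
    proof cases
      case 1
      have "x = 1" "y = 1/2" "y' = 1/2" using X(1)[OF 1] bz by blast+
      then show ?thesis using 1 eq(2) by simp
    next
      case 2
      have "x = 0" "y = 1/2" "y' = 1/2" using X(2)[OF 2] bz by blast+
      then show ?thesis using 2 eq(2) by simp
    next
      case 3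
      have "y = 1" "x = 1/2" using Y(1)[OF 3(2)] bz by blast+
      then show ?thesis using 3 by simp
    next
      case 4
      have "y = 0" "x = 1/2" using Y(2)[OF 4(2)] bz by blast+
      then show ?thesis using 4 by simp
    qed
  qed
  show "adjacent c d"
    using cases by (auto simp: cd adjacent_def)
  show "place a c z = doorway a c d"
  proof -
    have "x = (1 + real_of_int (i' - i)) / 2" "y = (1 + real_of_int (j' - j)) / 2"
      using cases by auto
    then show ?thesis
      by (simp only: cd doorway_def fst_conv snd_conv)
  qed
qed

section \<open>Cut points and short curves in the limit set\<close>

text \<open>The pieces meet at most in doorways and are arranged along a tree, so chains of cut points for the
  scaled copies combine to chains for the whole. The factor 5 is a lower bound for the widths that
  suffices for all levels.\<close>

lemma finely_cut_limit_step:
  assumes "finely_cut \<epsilon> (limit (Suc k))" "\<epsilon> \<ge> 0"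
  shows "finely_cut (\<epsilon> / 5) (limit k)"
proof -
  let ?a = "half_width k"
  let ?P = "\<lambda>c. place ?a c ` limit (Suc k)"
  have closed: "closed (?P c)" for c
    using compact_Int_closed[OF compact_approx[of "Suc k" 0] closed_limit[of "Suc k"]] limit_subset_approx[of "Suc k" 0]
    by (metis compact_imp_closed compact_continuous_image continuous_on_place inf.absorb2)
  have cut: "finely_cut (\<epsilon> / 5) (?P c)" for c
  proof -
    have "finely_cut (1 / real (2 * ?a + 1) * \<epsilon>) (?P c)"
    proof (rule finely_cut_image[OF dist_place _ _ _ assms(1)])
      let ?g = "\<lambda>w. (real (2 * ?a + 1) * fst w - real_of_int (fst c) - real ?a, real (2 * ?a + 1) * snd w - real_of_int (snd c) - real ?a)"
      show "?g (place ?a c u) = u" for u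
        by (cases u) (simp add: place_eq)
      show "continuous_on S ?g" for S
        by (intro continuous_intros)
    qed simp
    moreover have "\<epsilon> / real (2 * ?a + 1) \<le> \<epsilon> / 5"
      using half_width_ge[of k] assms(2) by (intro frac_le) auto
    ultimately show ?thesis
      by (auto intro: finely_cut_mono)
  qed
  have disj: "?P c \<inter> ?P d = {}" if "c \<noteq> d" "\<not> adjacent c d" for c d
  proof (rule ccontr)
    assume "?P c \<inter> ?P d \<noteq> {}"
    then obtain z z' where z: "z \<in> limit (Suc k)" "z' \<in> limit (Suc k)" "place ?a c z = place ?a d z'"
      by blast
    show False
      using places_meet(1)[OF that(1) z] that(2) by contradiction
  qed
  have meet: "\<exists>p. ?P c \<inter> ?P d = {p}" if "adjacent c d" for c d
  proof -
    have "doorway ?a c d \<in> ?P c \<inter> ?P d"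
      using doorway_exit[OF that] exits_subset_limit by blast
    moreover have "c \<noteq> d"
      using that by auto
    have "?P c \<inter> ?P d \<subseteq> {doorway ?a c d}"
    proof
      fix w assume "w \<in> ?P c \<inter> ?P d"
      then obtain z z' where z: "z \<in> limit (Suc k)" "z' \<in> limit (Suc k)" "w = place ?a c z" "place ?a c z = place ?a d z'"
        by fastforce
      show "w \<in> {doorway ?a c d}"
        using places_meet(2)[OF \<open>c \<noteq> d\<close> z(1,2,4)] z(3) by simp
    qed
    ultimately show ?thesis
      by blast
  qed
  have "leaf_grown (maze ?a)"
    unfolding maze_def by (rule leaf_grown_hooked_cross)
  then have "closed (\<Union>c\<in>maze ?a. ?P c) \<and> finely_cut (\<epsilon> / 5) (\<Union>c\<in>maze ?a. ?P c)"
    by (rule finely_cut_leaf_grown) (rule closed, rule cut, rule disj, assumption+, rule meet, assumption)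
  then show ?thesis
    by (simp only: limit_unfold[of k])
qed

lemma dist_unit_square: "x \<in> unit_square \<Longrightarrow> y \<in> unit_square \<Longrightarrow> dist x y \<le> 2"
proof -
  assume "x \<in> unit_square" "y \<in> unit_square"
  then have "dist (fst x) (fst y) \<le> 1" "dist (snd x) (snd y) \<le> 1"
    by (auto simp: unit_square_def dist_real_def abs_le_iff)
  then show ?thesis
    using sqrt_sum_squares_le_sum[of "dist (fst x) (fst y)" "dist (snd x) (snd y)"] by (simp add: dist_prod_def)
qed

lemma finely_cut_limit:
  assumes "\<epsilon> > 0"
  shows "finely_cut \<epsilon> (limit k)"
proof -
  have "finely_cut (2 * (1/5) ^ n) (limit k)" for n
  proof (induction n arbitrary: k)
    case 0
    show ?case
      using finely_cut_if_dist_le[of "limit k" 2] dist_unit_square limit_subset_unit_square by (simp add: subset_eq)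
  next
    case (Suc n)
    show ?case
      using finely_cut_limit_step[OF Suc[of "Suc k"]] by simp
  qed
  moreover obtain n where "(1/5::real) ^ n < \<epsilon> / 2"
    using real_arch_pow_inv[of "\<epsilon> / 2" "1/5"] assms by auto
  then have "2 * (1/5) ^ n \<le> \<epsilon>"
    by linarith
  ultimately show ?thesis
    using finely_cut_mono by blast
qed

lemma hooked_cross_mono:
  "l \<le> l' \<Longrightarrow> r \<le> r' \<Longrightarrow> t \<le> t' \<Longrightarrow> b \<le> b' \<Longrightarrow> hooked_cross l r t b \<subseteq> hooked_cross l' r' t' b'"
  unfolding hooked_cross_def by (intro Un_mono Sigma_mono subset_refl) auto

text \<open>The hook together with the one or two arms that lead to \<open>e\<close> and \<open>e'\<close> is a subtree of the pattern with
  at most four squares more than the width \<open>2 * a + 1\<close> of the grid. It is a route between the two exits,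
  apart from parts of the hook.\<close>

lemma exit_corridor:
  assumes "a \<ge> 2" "e \<in> exits" "e' \<in> exits"
  obtains T c d where "leaf_grown T" "T \<subseteq> maze a" "card T \<le> 2 * a + 5" "c \<in> T" "d \<in> T"
    "place a c e = e" "place a d e' = e'"
proof -
  define arm where "arm p = (if p = e \<or> p = e' then a - 1 else 0)" for p
  define T where "T = hooked_cross (arm (0, 1/2)) (arm (1, 1/2)) (arm (1/2, 1)) (arm (1/2, 0))"
  have arm_le: "arm p \<le> a - 1" for p
    by (simp add: arm_def)
  have "T \<subseteq> maze a"
    unfolding T_def maze_def by (intro hooked_cross_mono arm_le)
  moreover have "card T \<le> 2 * a + 5"
  proof -
    have "card T \<le> 7 + arm (0, 1/2) + arm (1, 1/2) + arm (1/2, 1) + arm (1/2, 0)"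
      unfolding T_def by (rule card_hooked_cross)
    also have "\<dots> \<le> 7 + 2 * (a - 1)"
      using assms(2,3) unfolding exits_def arm_def by (elim insertE emptyE) simp_all
    finally show ?thesis
      using assms(1) by linarith
  qed
  moreover have "\<exists>c\<in>T. place a c p = p" if "p \<in> exits" "p = e \<or> p = e'" for p
  proof -
    have "arm p = a - 1"
      using that(2) by (simp add: arm_def)
    then have "p = (0, 1/2) \<Longrightarrow> (- int a, 0) \<in> T" "p = (1, 1/2) \<Longrightarrow> (int a, 0) \<in> T"
      "p = (1/2, 0) \<Longrightarrow> (0, - int a) \<in> T" "p = (1/2, 1) \<Longrightarrow> (0, int a) \<in> T"
      using assms(1) unfolding T_def mem_hooked_cross by (auto simp: of_nat_diff)
    then show ?thesis
      using that(1) place_exit[of a] unfolding exits_def by blast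
  qed
  moreover have "leaf_grown T"
    unfolding T_def by (rule leaf_grown_hooked_cross)
  ultimately show ?thesis
    using that assms(2,3) by metis
qed

lemma joined_place:
  "joined C S x y \<Longrightarrow> joined (C / real (2 * a + 1)) (place a c ` S) (place a c x) (place a c y)"
  using joined_image[where h = "place a c" and q = "1 / real (2 * a + 1)", OF _ dist_place] by simp

lemma joined_corridor:
  assumes T: "leaf_grown T" "T \<subseteq> maze (half_width k)" "real (card T) * (C / real (2 * half_width k + 1)) \<le> D" and "C \<ge> 0"
    and exits: "\<And>e e'. e \<in> exits \<Longrightarrow> e' \<in> exits \<Longrightarrow> joined C (approx (Suc k) n) e e'"
    and cd: "c \<in> T" "d \<in> T" "e \<in> exits" "e' \<in> exits"
  shows "joined D (approx k (Suc n)) (place (half_width k) c e) (place (half_width k) d e')"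
proof -
  let ?a = "half_width k"
  let ?Q = "\<lambda>c. place ?a c ` approx (Suc k) n" and ?X = "\<lambda>c. place ?a c ` exits"
  have "finite T \<and> (\<forall>c\<in>T. \<forall>d\<in>T. \<forall>e\<in>?X c. \<forall>e'\<in>?X d.
      joined (real (card T) * (C / real (2 * ?a + 1))) (\<Union>c\<in>T. ?Q c) e e')"
  proof (rule joined_leaf_grown[OF T(1)])
    show "joined (C / real (2 * ?a + 1)) (?Q c) e e'" if "e \<in> ?X c" "e' \<in> ?X c" for c e e'
      using that by (elim imageE, hypsubst) (intro joined_place exits)
    show "?X c \<inter> ?X d \<noteq> {}" if "adjacent c d" for c d
      using doorway_exit[OF that] by blast
  qed (use \<open>C \<ge> 0\<close> in simp)
  then have "joined (real (card T) * (C / real (2 * ?a + 1))) (\<Union>c\<in>T. ?Q c) (place ?a c e) (place ?a d e')"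
    using cd by blast
  then show ?thesis
    by (rule joined_mono) (use T(2,3) in auto)
qed

lemma dist_exits_le: "e \<in> exits \<Longrightarrow> e' \<in> exits \<Longrightarrow> dist e e' \<le> 1"
  unfolding exits_def by (elim insertE emptyE) (simp_all add: dist_Pair_Pair dist_real_def power2_eq_square)

text \<open>Induction over the levels: a corridor of at most \<open>m + 4\<close> squares, each crossed by a curve that is
  scaled by \<open>1 / m\<close>, multiplies the length by \<open>1 + 4 / m\<close>. The bound \<open>1 + 1 / 2 ^ k\<close> is chosen so that the
  growth of the widths makes it reproduce itself.\<close>

lemma joined_exits:
  assumes "e \<in> exits" "e' \<in> exits"
  shows "joined (1 + 1 / 2 ^ k) (approx k n) e e'"
  using assms
proof (induction n arbitrary: k e e')
  case 0
  have "e \<in> unit_square" "e' \<in> unit_square"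
    using 0 exits_subset_approx[of 0 0] by auto
  then show ?case
    using dist_exits_le[OF 0] by (auto intro!: joined_convex simp: unit_square_def convex_Times add_increasing2)
next
  case (Suc n)
  let ?a = "half_width k"
  obtain T c d where T: "leaf_grown T" "T \<subseteq> maze ?a" "card T \<le> 2 * ?a + 5" "c \<in> T" "d \<in> T"
    "place ?a c e = e" "place ?a d e' = e'"
    using exit_corridor[OF half_width_ge2 Suc.prems] .
  \<comment> \<open>In terms of \<open>t = 2 ^ k\<close> the width is \<open>16 * t + 1\<close>, and the claim is a rational inequality.\<close>
  define t :: real where "t = 2 ^ k"
  have t: "t \<ge> 1" "real ?a = 8 * t"
    by (simp_all add: t_def half_width_def)
  have "real (card T) * ((1 + 1 / 2 ^ Suc k) / real (2 * ?a + 1)) \<le> real (2 * ?a + 5) * ((1 + 1 / 2 ^ Suc k) / real (2 * ?a + 1))"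
    using T(3) by (intro mult_right_mono) (auto intro!: add_nonneg_nonneg)
  also have "\<dots> = (16 * t + 5) * (1 + 1 / (2 * t)) / (16 * t + 1)"
    using t by (simp add: t_def)
  also have "\<dots> \<le> 1 + 1 / t"
  proof -
    have "(16 * t + 5) * (1 + 1 / (2 * t)) = 16 * t + 13 + 5 / (2 * t)"
      using t(1) by (simp add: field_simps)
    moreover have "(1 + 1 / t) * (16 * t + 1) = 16 * t + 17 + 1 / t"
      using t(1) by (simp add: field_simps)
    moreover have "5 / (2 * t) \<le> 5 / 2" "0 \<le> 1 / t"
      using t(1) by (auto simp: field_simps)
    ultimately have "(16 * t + 5) * (1 + 1 / (2 * t)) \<le> (1 + 1 / t) * (16 * t + 1)"
      by linarith
    then show ?thesis
      using t(1) by (simp add: pos_divide_le_eq)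
  qed
  finally have "real (card T) * ((1 + 1 / 2 ^ Suc k) / real (2 * ?a + 1)) \<le> 1 + 1 / 2 ^ k"
    by (simp add: t_def)
  then have "joined (1 + 1 / 2 ^ k) (approx k (Suc n)) (place ?a c e) (place ?a d e')"
    by (rule joined_corridor[OF T(1,2) _ _ Suc.IH T(4,5) Suc.prems]) (auto intro!: add_nonneg_nonneg)
  then show ?case
    using T by simp
qed

text \<open>The curve leaves the square of \<open>x\<close> through one of its exits, with a length bounded by
  induction, and then runs through white squares of the first level to the exit \<open>e\<close>. As there are fewer
  than \<open>3 * m\<close> such squares, the second part has length at most 6. The constant 8 is admissible since
  \<open>8 / m + 6 \<le> 8\<close>.\<close>

lemma joined_to_exit:
  assumes "x \<in> approx k n" "e \<in> exits"
  shows "joined 8 (approx k n) x e"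
  using assms
proof (induction n arbitrary: k x e)
  case 0
  have "e \<in> unit_square"
    using 0(2) exits_subset_approx[of 0 0] by auto
  then show ?case
    using dist_unit_square[of x e] 0 by (auto intro!: joined_convex simp: unit_square_def convex_Times)
next
  case (Suc n)
  let ?a = "half_width k"
  obtain c x' where c: "c \<in> maze ?a" "x' \<in> approx (Suc k) n" "x = place ?a c x'"
    using Suc.prems(1) by auto
  obtain d where d: "d \<in> maze ?a" "place ?a d e = e"
    using exit_corridor[OF half_width_ge2 Suc.prems(2,2)] by (metis subsetD)
  have "joined (8 / real (2 * ?a + 1)) (approx k (Suc n)) x (place ?a c e)"
    unfolding c(3) by (rule joined_mono[OF joined_place[OF Suc.IH[OF c(2) Suc.prems(2)]]]) (use c(1) in auto)
  moreover have "8 / real (2 * ?a + 1) \<le> 2"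
    using half_width_ge[of k] by (simp add: field_simps)
  ultimately have "joined 2 (approx k (Suc n)) x (place ?a c e)"
    using joined_mono by blast
  moreover have "joined 6 (approx k (Suc n)) (place ?a c e) (place ?a d e)"
  proof (rule joined_corridor[where C = 2])
    show "leaf_grown (maze ?a)"
      unfolding maze_def by (rule leaf_grown_hooked_cross)
    have "card (maze ?a) \<le> 7 + 4 * (?a - 1)"
      using card_hooked_cross(2)[of "?a - 1" "?a - 1" "?a - 1" "?a - 1"] by (simp add: maze_def)
    then have "card (maze ?a) \<le> 6 * ?a + 3"
      using half_width_ge[of k] by linarith
    then have "real (card (maze ?a)) \<le> real (3 * (2 * ?a + 1))"
      by (subst of_nat_le_iff) simp
    also have "\<dots> = 3 * real (2 * ?a + 1)"
      by simp
    finally have "real (card (maze ?a)) \<le> 3 * real (2 * ?a + 1)" .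
    then have "real (card (maze ?a)) * (2 / real (2 * ?a + 1)) \<le> 3 * real (2 * ?a + 1) * (2 / real (2 * ?a + 1))"
      by (intro mult_right_mono) auto
    also have "\<dots> = 6"
    proof -
      have "3 * m * (2 / m) = 6" if "m > 0" for m :: real
        using that by simp
      from this[of "real (2 * ?a + 1)"] show ?thesis
        by (simp only: of_nat_0_less_iff)
    qed
    finally show "real (card (maze ?a)) * (2 / real (2 * ?a + 1)) \<le> 6" .
    show "joined 2 (approx (Suc k) n) e e'" if "e \<in> exits" "e' \<in> exits" for e e'
    proof (rule joined_mono[OF joined_exits[OF that] _ subset_refl])
      have "(1::real) \<le> 2 ^ Suc k"
        by (rule one_le_power) simp
      then show "1 + 1 / 2 ^ Suc k \<le> (2::real)"
        by (simp add: divide_le_eq_1 del: power_Suc)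
    qed
  qed (use c d Suc.prems(2) in auto)
  ultimately show ?case
    using joined_trans[of 2 _ x _ 6] d(2) by fastforce
qed

text \<open>The bound is uniform in the level, so it passes to the intersection.\<close>

lemma joined_limit:
  assumes "x \<in> limit k" "y \<in> limit k"
  shows "joined 16 (limit k) x y"
  unfolding limit_def
proof (rule joined_INT[OF decseq_approx])
  fix n
  show "closed (approx k n)" "bounded (approx k 0)"
    using compact_approx compact_imp_closed compact_imp_bounded by blast+
  have "(0, 1/2) \<in> exits"
    by (simp add: exits_def)
  then have "joined 8 (approx k n) x (0, 1/2)" "joined 8 (approx k n) y (0, 1/2)"
    using joined_to_exit assms limit_subset_approx by blast+
  then show "joined 16 (approx k n) x y"
    using joined_trans[OF _ joined_sym] by fastforce
qed

section \<open>Agreement with the white squares of level n\<close>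

text \<open>The maps taking the unit square onto the white squares of level \<open>n\<close>, for the sequence of patterns
  starting at index \<open>k\<close>. Working with the maps gives associativity for free, which turns a
  recursion on the coarsest pattern into one on the finest.\<close>

fun frames :: "nat \<Rightarrow> nat \<Rightarrow> (real \<times> real \<Rightarrow> real \<times> real) set" where
  "frames k 0 = {id}"
| "frames k (Suc n) = {place (half_width k) c \<circ> h | c h. c \<in> maze (half_width k) \<and> h \<in> frames (Suc k) n}"

lemma frames_Suc_last:
  "frames k (Suc n) = {h \<circ> place (half_width (k + n)) c | c h. c \<in> maze (half_width (k + n)) \<and> h \<in> frames k n}"
proof (induction n arbitrary: k)
  case (Suc n)
  have "frames k (Suc (Suc n)) = {place (half_width k) c \<circ> (h \<circ> place (half_width (k + Suc n)) d) | c h d.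
      c \<in> maze (half_width k) \<and> h \<in> frames (Suc k) n \<and> d \<in> maze (half_width (k + Suc n))}"
    unfolding frames.simps(2)[of k "Suc n"] Suc[of "Suc k"] by (auto; blast)
  also have "\<dots> = {h \<circ> place (half_width (k + Suc n)) c | c h. c \<in> maze (half_width (k + Suc n)) \<and> h \<in> frames k (Suc n)}"
    unfolding frames.simps(2)[of k n] comp_assoc[symmetric] by blast
  finally show ?case .
qed auto

lemma frames_rescale:
  assumes "h \<in> frames k n"
  shows "\<exists>x y q. q > 0 \<and> h = rescale x y q"
  using assms
proof (induction n arbitrary: k h)
  case 0
  then have "h = rescale 0 0 1"
    by (auto simp: rescale_def)
  then show ?case
    using zero_less_one by blast
next
  case (Suc n)
  then obtain c h' x y q where h: "h = place (half_width k) c \<circ> h'" "q > 0" "h' = rescale x y q"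
    by force
  have comp: "rescale u v r \<circ> rescale x y q = rescale (u + r * x) (v + r * y) (r * q)" for u v r
    by (auto simp: rescale_def algebra_simps)
  have "1 / real (2 * half_width k + 1) * q > 0"
    using h(2) by simp
  then show ?case
    unfolding h(1,3) place_def comp by blast
qed

lemma approx_frames: "approx k n = (\<Union>h\<in>frames k n. h ` unit_square)"
proof (induction n arbitrary: k)
  case (Suc n)
  show ?case
    unfolding approx.simps(2) Suc[of "Suc k"] by (auto simp: image_comp; fastforce)
qed simp

definition maze_pattern :: "nat \<Rightarrow> plane_set set" where
  "maze_pattern k = cell (half_width k) ` maze (half_width k)"

lemma maze_pattern_eq: "maze_pattern k = {place (half_width k) c ` unit_square | c. c \<in> maze (half_width k)}"
proof -
  have "maze_pattern k = (\<lambda>c. place (half_width k) c ` unit_square) ` maze (half_width k)"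
    unfolding maze_pattern_def by (intro image_cong refl cell_eq_place maze_in_box)
  then show ?thesis
    by blast
qed

text \<open>A white square determines the scaling map that takes the unit square onto it, so choosing a white
  square and its position and size amounts to choosing a map in \<open>frames\<close>.\<close>

lemma white_squares_maze_pattern:
  "white_squares maze_pattern (Suc n) = (\<lambda>h. h ` unit_square) ` frames 1 (Suc n)"
proof (induction n)
  case 0
  show ?case
    by (auto simp: maze_pattern_eq)
next
  case (Suc n)
  have h: "(\<exists>x y q. f = rescale x y q \<and> q > 0 \<and> square x y q \<in> (\<lambda>h. h ` unit_square) ` frames 1 (Suc n)) \<longleftrightarrow>
      f \<in> frames 1 (Suc n)" for f
  proof
    assume "\<exists>x y q. f = rescale x y q \<and> q > 0 \<and> square x y q \<in> (\<lambda>h. h ` unit_square) ` frames 1 (Suc n)"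
    then obtain x y q h where f: "f = rescale x y q" "q > 0" "square x y q = h ` unit_square" "h \<in> frames 1 (Suc n)"
      by blast
    obtain x' y' q' where h: "q' > 0" "h = rescale x' y' q'"
      using frames_rescale[OF f(4)] by blast
    then have "square x y q = square x' y' q'"
      using f(3) by (simp add: rescale_unit_square)
    then have "f = h"
      using f(1,2) h by (simp add: square_eq_iff)
    then show "f \<in> frames 1 (Suc n)"
      using f(4) by simp
  next
    assume f: "f \<in> frames 1 (Suc n)"
    then obtain x y q where "q > 0" "f = rescale x y q"
      using frames_rescale by blast
    then show "\<exists>x y q. f = rescale x y q \<and> q > 0 \<and> square x y q \<in> (\<lambda>h. h ` unit_square) ` frames 1 (Suc n)"
      using f rescale_unit_square[of q x y] by (metis imageI)
  qed
  have "white_squares maze_pattern (Suc (Suc n)) = {f ` W | f W. W \<in> maze_pattern (Suc (Suc n)) \<and>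
      (\<exists>x y q. f = rescale x y q \<and> q > 0 \<and> square x y q \<in> (\<lambda>h. h ` unit_square) ` frames 1 (Suc n))}"
    unfolding white_squares.simps Suc by blast
  also have "\<dots> = {f ` place (half_width (Suc (Suc n))) c ` unit_square | f c.
      c \<in> maze (half_width (Suc (Suc n))) \<and> f \<in> frames 1 (Suc n)}"
    unfolding h maze_pattern_eq by blast
  also have "\<dots> = (\<lambda>h. h ` unit_square) ` frames 1 (Suc (Suc n))"
  proof -
    have "{f ` p c ` U | f c. c \<in> M \<and> f \<in> F} = (\<lambda>h. h ` U) ` {f \<circ> p c | c f. c \<in> M \<and> f \<in> F}"
      for p :: "int \<times> int \<Rightarrow> real \<times> real \<Rightarrow> real \<times> real" and U M and F :: "(real \<times> real \<Rightarrow> real \<times> real) set"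
      unfolding image_comp by blast
    then show ?thesis
      unfolding frames_Suc_last[of 1 "Suc n"] plus_1_eq_Suc .
  qed
  finally show ?case .
qed

lemma limit_set_maze_pattern: "limit_set maze_pattern = limit 1"
proof -
  have "\<Union> (white_squares maze_pattern (Suc n)) = approx 1 (Suc n)" for n
    unfolding white_squares_maze_pattern approx_frames by simp
  moreover have "{1..} = range Suc"
    by (auto simp: image_iff dest: Suc_le_D)
  ultimately have "limit_set maze_pattern = (\<Inter>n. approx 1 (Suc n))"
    unfolding limit_set_def by simp
  also have "\<dots> = limit 1"
    unfolding limit_def using approx_Suc_subset by blast
  finally show ?thesis .
qed

theorem proposition3:
  shows "\<exists>(m :: nat \<Rightarrow> nat) (A :: nat \<Rightarrow> (real \<times> real) set set).
    (\<forall>k\<ge>1. labyrinth_pattern (m k) (A k) \<and>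
       horizontally_blocked (m k) (A k) \<and> vertically_blocked (m k) (A k)) \<and>
    (\<forall>x\<in>limit_set A. \<forall>y\<in>limit_set A. x \<noteq> y \<longrightarrow>
       (\<exists>g. arc_in (limit_set A) x y g) \<and>
       (\<forall>g. arc_in (limit_set A) x y g \<longrightarrow> path_length g < \<infinity>))"
proof (intro exI[of _ "\<lambda>k. 2 * half_width k + 1"] exI[of _ maze_pattern] conjI ballI allI impI)
  fix k
  show "labyrinth_pattern (2 * half_width k + 1) (maze_pattern k)"
    "horizontally_blocked (2 * half_width k + 1) (maze_pattern k)"
    "vertically_blocked (2 * half_width k + 1) (maze_pattern k)"
    unfolding maze_pattern_def by (rule maze_labyrinth_pattern[OF half_width_ge2])+
next
  fix x y assume "x \<in> limit_set maze_pattern" "y \<in> limit_set maze_pattern" and "x \<noteq> y"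
  then have join: "joined 16 (limit 1) x y"
    by (simp add: limit_set_maze_pattern joined_limit)
  show "\<exists>g. arc_in (limit_set maze_pattern) x y g"
    unfolding limit_set_maze_pattern by (rule joined_imp_arc[OF join \<open>x \<noteq> y\<close>])
  show "path_length g < \<infinity>" if "arc_in (limit_set maze_pattern) x y g" for g
    using path_length_arc_finite[OF finely_cut_limit _ join] that by (simp add: limit_set_maze_pattern)
qed

end
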